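(* Let $G$ be a group acting by homeomorphisms on a locally compact space $X$, and let $M(X)$ be the Banach space of finite Radon measures on $X$, with the induced linear isometric $G$-action $\mu\mapsto g.\mu$. Then any bounded cocycle $b:G\to M(X)$ is trivial. More precisely, there is a measure $\mu\in M(X)$ with $\|\mu\|\leq \sup_{g\in G}\|b(g)\|$ such that $b(g)=\mu-g.\mu$ for all $g\in G$.
   Context: Locally compact spaces are Hausdorff. $M(X)$ consists of the finite signed (or complex) Radon measures on $X$ with the total variation norm, i.e. it is the dual of $C_0(X)$. The group $G$ acts on $M(X)$ by push-forward of measures. A cocycle is a map $b:G\to M(X)$ with $b(gh)=b(g)+g.b(h)$ for all $g,h\in G$; it is bounded if $\sup_{g\in G}\|b(g)\|<\infty$. It is trivial if there is $\mu\in M(X)$ with $b(g)=\mu-g.\mu$ for all $g\in G$. No topology on $G$ and no continuity of $b$ is assumed. *)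

theory Defs
  imports "HOL-Analysis.Analysis" "HOL-Algebra.Group_Action"
begin

definition borel_sets_of :: "'x topology \<Rightarrow> 'x set set" where
  "borel_sets_of X = sigma_sets (topspace X) {U. openin X U}"

text \<open>
  A measure is represented by its set function, with scalars of sort
  \<open>{real_normed_field, euclidean_space}\<close>. A finite-dimensional real field with a
  multiplicative norm is isometrically isomorphic to the reals or the complex numbers, so this
  sort covers exactly the signed and the complex measures.
\<close>

text \<open>The variation is \<open>ennreal\<close>-valued so that the supremum needs no boundedness proof.\<close>

definition variation ::
    "'x topology \<Rightarrow> ('x set \<Rightarrow> 'k::{real_normed_field, euclidean_space}) \<Rightarrow> 'x set \<Rightarrow> ennreal" where
  "variation X \<mu> A =
     (SUP P \<in> {P. finite P \<and> P \<subseteq> borel_sets_of X \<and> partition_on A P}.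
        \<Sum>B\<in>P. ennreal (norm (\<mu> B)))"

definition tv_norm ::
    "'x topology \<Rightarrow> ('x set \<Rightarrow> 'k::{real_normed_field, euclidean_space}) \<Rightarrow> ennreal" where
  "tv_norm X \<mu> = variation X \<mu> (topspace X)"

text \<open>
  The space \<open>M(X)\<close>. Set functions vanish off the Borel sets, so that equality of measures is
  equality of functions. Finiteness is implicit in the scalar type. The Radon condition is inner
  regularity of the variation by compact sets on all Borel sets; as the variation is finite, outer
  regularity by open sets follows by taking complements.
\<close>

definition radon_measures ::
    "'x topology \<Rightarrow> ('x set \<Rightarrow> 'k::{real_normed_field, euclidean_space}) set" where
  "radon_measures X =
     {\<mu>. (\<forall>A. A \<notin> borel_sets_of X \<longrightarrow> \<mu> A = 0) \<and>
          (\<forall>A :: nat \<Rightarrow> 'x set. range A \<subseteq> borel_sets_of X \<longrightarrow> disjoint_family A \<longrightarrow>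
              (\<lambda>i. \<mu> (A i)) sums \<mu> (\<Union>i. A i)) \<and>
          (\<forall>A \<in> borel_sets_of X. \<forall>e > 0.
              \<exists>K. compactin X K \<and> K \<subseteq> A \<and> variation X \<mu> (A - K) < e)}"

definition pushforward ::
    "'x topology \<Rightarrow> ('x \<Rightarrow> 'x) \<Rightarrow> ('x set \<Rightarrow> 'k::{real_normed_field, euclidean_space})
       \<Rightarrow> 'x set \<Rightarrow> 'k" where
  "pushforward X f \<mu> A = (if A \<in> borel_sets_of X then \<mu> (f -` A \<inter> topspace X) else 0)"

definition measure_cocycle ::
    "('g, 'm) monoid_scheme \<Rightarrow> 'x topology \<Rightarrow> ('g \<Rightarrow> 'x \<Rightarrow> 'x)
       \<Rightarrow> ('g \<Rightarrow> 'x set \<Rightarrow> 'k::{real_normed_field, euclidean_space}) \<Rightarrow> bool" where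
  "measure_cocycle G X \<phi> b \<longleftrightarrow>
     b \<in> carrier G \<rightarrow> radon_measures X \<and>
     (\<forall>g \<in> carrier G. \<forall>h \<in> carrier G.
        b (g \<otimes>\<^bsub>G\<^esub> h) = (\<lambda>A. b g A + pushforward X (\<phi> g) (b h) A))"

end

theory Submission
  imports Defs
begin

text \<open>
A cocycle \<open>b\<close> is the same thing as an affine isometric action
\<open>\<nu> \<mapsto> b g + g.\<nu>\<close> on \<open>M(X)\<close>, in which \<open>0\<close> has the orbit \<open>{b g}\<close>, and a measure
\<open>\<mu>\<close> with \<open>b g = \<mu> - g.\<mu>\<close> is a fixed point of it. In a Hilbert space a bounded orbit has a fixed
point, its circumcentre. The space \<open>M(X)\<close> is far from being a Hilbert space, but it maps
equivariantly into one. For real densities with respect to a dominating measure \<open>M\<close>, send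
\<open>f\<close> to the indicator of its subgraph \<open>{(x, t). t < f x}\<close>. The identity
\<open>\<bar>p - q\<bar> = \<integral> (1[t < p] - 1[t < q])\<^sup>2 dt\<close> shows that the \<open>L\<^sup>1\<close> distance of two densities is the squared
\<open>L\<^sup>2(M \<times> dt)\<close> distance of their subgraphs, and the affine action on densities becomes a
measure preserving action \<open>(x, t) \<mapsto> (g x, r t + z)\<close> on \<open>X \<times> \<real>\<close>. A measure with values in
a Euclidean space is treated one coordinate at a time, with the sum of the squared distances.

The group may be uncountable, and there may be no measure that dominates all its translates, so
the Hilbert space is not constructed as a whole. Only the kernel \<open>gap h h'\<close> is needed, the squared
distance between the points of the orbit, which does not depend on the dominating measure. It is bounded
and invariant, and the integral formula shows that it is conditionally negative definite.
The parallelogram law then gives finite probability distributions \<open>c n\<close> on the group, almost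
minimising the circumradius, that are Cauchy and asymptotically invariant in the seminorm given by
the kernel (\<open>asymptotically_invariant_centres\<close>). They are carried by a countable subset of the group,
hence all the measures involved have densities \<open>\<beta> h\<close> with respect to one Radon measure \<open>M\<close>.

Because the errors decay geometrically, convergence in \<open>L\<^sup>2\<close> improves to convergence almost
everywhere: for almost every \<open>x\<close>, in the real case, the distributions
\<open>\<Sum>h. c n h * \<delta>(\<beta> h x)\<close> on the line have tail functions that converge almost everywhere to
some \<open>F\<close>. The fixed point has as its density at \<open>x\<close> the mean \<open>w x = \<integral> (F t - 1[t < 0]) dt\<close> of
the limit distribution. The mean is finite, and the norm bound holds, by Fatou's lemma applied to
\<open>\<Sum>h. c n h * \<bar>\<beta> h x\<bar>\<close>, whose integral is at most \<open>sup \<parallel>b g\<parallel>\<close> (\<open>limit_measure\<close>). The means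
\<open>\<Sum>h. c n h * b h\<close> themselves need not converge, which is why tail functions are used in their place.

For the invariance under one \<open>g\<close>, the measures \<open>M\<close>, \<open>g.M\<close> and \<open>b g\<close> are all expressed by densities
with respect to a common measure. In terms of these the action is \<open>t \<mapsto> \<zeta> x + r * t\<close> on each fibre, means
respect such maps (\<open>limit_mean_affine\<close>), and asymptotic invariance says that the tail functions of
\<open>c n\<close> and of its translate by \<open>g\<close> have the same limit (\<open>limit_measure_equivariant\<close>).
\<close>

section \<open>Energies and asymptotically invariant circumcentres\<close>

text \<open>
If \<open>s\<close> has sum \<open>0\<close> and \<open>K i j\<close> is the squared distance of points \<open>v i\<close>, \<open>v j\<close> of a Hilbert space,
this is the squared norm of \<open>\<Sum>i. s i *\<^sub>R v i\<close>.
\<close>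

definition energy :: "('g \<Rightarrow> 'g \<Rightarrow> real) \<Rightarrow> ('g \<Rightarrow> real) \<Rightarrow> real" where
  "energy K s = - (1/2) * (\<Sum>i | s i \<noteq> 0. \<Sum>j | s j \<noteq> 0. s i * s j * K i j)"

text \<open>
Finite probability distributions are kept as weight functions, so that the difference of two of them
is a weight function with sum \<open>0\<close>, to which \<open>energy\<close> applies.
\<close>

definition fin_prob :: "'g set \<Rightarrow> ('g \<Rightarrow> real) set" where
  "fin_prob C = {c. finite {h. c h \<noteq> 0} \<and> {h. c h \<noteq> 0} \<subseteq> C \<and> (\<forall>h. 0 \<le> c h) \<and>
     (\<Sum>h | c h \<noteq> 0. c h) = 1}"

text \<open>
The image of the weights under left multiplication by \<open>g\<close>.
\<close>

definition translate :: "('g, 'm) monoid_scheme \<Rightarrow> 'g \<Rightarrow> ('g \<Rightarrow> real) \<Rightarrow> 'g \<Rightarrow> real" where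
  "translate G g s h = (if h \<in> carrier G then s (inv\<^bsub>G\<^esub> g \<otimes>\<^bsub>G\<^esub> h) else 0)"

lemma sum_support_superset:
  fixes s :: "'g \<Rightarrow> real"
  assumes "finite F" "{h. s h \<noteq> 0} \<subseteq> F"
  shows "(\<Sum>h | s h \<noteq> 0. s h * f h) = (\<Sum>h\<in>F. s h * f h)"
  using assms by (intro sum.mono_neutral_left) auto

lemma energy_superset:
  assumes "finite F" "{h. s h \<noteq> 0} \<subseteq> F"
  shows "energy K s = - (1/2) * (\<Sum>i\<in>F. \<Sum>j\<in>F. s i * s j * K i j)"
proof -
  have "(\<Sum>i | s i \<noteq> 0. \<Sum>j | s j \<noteq> 0. s i * s j * K i j) =
        (\<Sum>i | s i \<noteq> 0. s i * (\<Sum>j\<in>F. s j * K i j))"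
    using sum_support_superset[OF assms] by (simp add: sum_distrib_left mult.assoc)
      (simp only: sum_distrib_left[symmetric] sum_support_superset[OF assms])
  also have "\<dots> = (\<Sum>i\<in>F. \<Sum>j\<in>F. s i * s j * K i j)"
    by (subst sum_support_superset[OF assms]) (simp add: sum_distrib_left mult.assoc)
  finally show ?thesis by (simp add: energy_def)
qed

text \<open>
This is an identity of bilinear forms: it holds termwise in the double sum, whatever \<open>K\<close> is.
\<close>

lemma energy_parallelogram:
  assumes "finite {h. s h \<noteq> 0}" "finite {h. s' h \<noteq> 0}"
  shows "energy K (\<lambda>h. (s h + s' h) / 2) =
    energy K s / 2 + energy K s' / 2 - energy K (\<lambda>h. s h - s' h) / 4"
proof -
  let ?F = "{h. s h \<noteq> 0} \<union> {h. s' h \<noteq> 0}"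
  have F: "finite ?F" using assms by simp
  have "(\<Sum>i\<in>?F. \<Sum>j\<in>?F. ((s i + s' i) / 2) * ((s j + s' j) / 2) * K i j) =
      (\<Sum>i\<in>?F. \<Sum>j\<in>?F. (s i * s j * K i j) / 2 + (s' i * s' j * K i j) / 2
        - ((s i - s' i) * (s j - s' j) * K i j) / 4)"
    by (intro sum.cong refl) (simp add: field_simps)
  also have "\<dots> = (\<Sum>i\<in>?F. \<Sum>j\<in>?F. s i * s j * K i j) / 2 + (\<Sum>i\<in>?F. \<Sum>j\<in>?F. s' i * s' j * K i j) / 2
        - (\<Sum>i\<in>?F. \<Sum>j\<in>?F. (s i - s' i) * (s j - s' j) * K i j) / 4"
    by (simp add: sum.distrib sum_subtractf sum_divide_distrib)
  finally have sums: "(\<Sum>i\<in>?F. \<Sum>j\<in>?F. ((s i + s' i) / 2) * ((s j + s' j) / 2) * K i j) = \<dots>" .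
  have "energy K s = - (1/2) * (\<Sum>i\<in>?F. \<Sum>j\<in>?F. s i * s j * K i j)" "energy K s' = - (1/2) * (\<Sum>i\<in>?F. \<Sum>j\<in>?F. s' i * s' j * K i j)"
    "energy K (\<lambda>h. s h - s' h) = - (1/2) * (\<Sum>i\<in>?F. \<Sum>j\<in>?F. (s i - s' i) * (s j - s' j) * K i j)"
    "energy K (\<lambda>h. (s h + s' h) / 2) = - (1/2) * (\<Sum>i\<in>?F. \<Sum>j\<in>?F. ((s i + s' i) / 2) * ((s j + s' j) / 2) * K i j)"
    by (rule energy_superset[OF F]; auto)+
  then show ?thesis unfolding sums by argo
qed

lemma fin_prob_midpoint:
  assumes "c \<in> fin_prob C" "d \<in> fin_prob C"
  shows "(\<lambda>h. (c h + d h) / 2) \<in> fin_prob C"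
proof -
  let ?m = "\<lambda>h. (c h + d h) / 2"
  let ?F = "{h. c h \<noteq> 0} \<union> {h. d h \<noteq> 0}"
  have F: "finite ?F" and sub: "{h. ?m h \<noteq> 0} \<subseteq> ?F" using assms by (auto simp: fin_prob_def)
  have "(\<Sum>h | ?m h \<noteq> 0. ?m h) = (\<Sum>h\<in>?F. ?m h)"
    using sum_support_superset[OF F sub, of "\<lambda>_. 1"] by simp
  also have "\<dots> = ((\<Sum>h\<in>?F. c h) + (\<Sum>h\<in>?F. d h)) / 2"
    by (simp add: sum_divide_distrib[symmetric] sum.distrib[symmetric])
  also have "(\<Sum>h\<in>?F. c h) = 1"
    using sum_support_superset[OF F, of c "\<lambda>_. 1"] assms by (simp add: fin_prob_def)
  also have "(\<Sum>h\<in>?F. d h) = 1"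
    using sum_support_superset[OF F, of d "\<lambda>_. 1"] assms by (simp add: fin_prob_def)
  finally have "(\<Sum>h | ?m h \<noteq> 0. ?m h) = 1" by simp
  moreover have "finite {h. ?m h \<noteq> 0}" by (rule finite_subset[OF sub F])
  ultimately show ?thesis using assms sub by (auto simp: fin_prob_def)
qed

lemma fin_prob_indicator: "g \<in> C \<Longrightarrow> indicator {g} \<in> fin_prob C"
proof -
  assume "g \<in> C"
  moreover have "{h. (indicator {g} h :: real) \<noteq> 0} = {g}" by (auto simp: indicator_def)
  ultimately show ?thesis by (simp add: fin_prob_def)
qed

lemma fin_prob_diff:
  assumes "c \<in> fin_prob C" "d \<in> fin_prob C"
  shows "finite {h. c h - d h \<noteq> 0}" "{h. c h - d h \<noteq> 0} \<subseteq> C" "(\<Sum>h | c h - d h \<noteq> 0. c h - d h) = 0"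
proof -
  let ?F = "{h. c h \<noteq> 0} \<union> {h. d h \<noteq> 0}"
  have F: "finite ?F" and sub: "{h. c h - d h \<noteq> 0} \<subseteq> ?F" using assms by (auto simp: fin_prob_def)
  show "finite {h. c h - d h \<noteq> 0}" by (rule finite_subset[OF sub F])
  show "{h. c h - d h \<noteq> 0} \<subseteq> C" using assms sub by (auto simp: fin_prob_def)
  have "(\<Sum>h | c h - d h \<noteq> 0. c h - d h) = (\<Sum>h\<in>?F. c h) - (\<Sum>h\<in>?F. d h)"
    using sum_support_superset[OF F sub, of "\<lambda>_. 1"] by (simp add: sum_subtractf)
  also have "\<dots> = 0"
    using sum_support_superset[OF F, of c "\<lambda>_. 1"] sum_support_superset[OF F, of d "\<lambda>_. 1"] assms
    by (simp add: fin_prob_def)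
  finally show "(\<Sum>h | c h - d h \<noteq> 0. c h - d h) = 0" .
qed

text \<open>
Guarantees that circumradii are finite: the signed weights have total mass at most \<open>2\<close>.
\<close>

lemma energy_bound:
  assumes c: "c \<in> fin_prob C" and d: "d \<in> fin_prob C"
    and K: "\<And>i j. i \<in> C \<Longrightarrow> j \<in> C \<Longrightarrow> \<bar>K i j\<bar> \<le> B"
  shows "energy K (\<lambda>h. c h - d h) \<le> 2 * B"
proof -
  let ?F = "{h. c h \<noteq> 0} \<union> {h. d h \<noteq> 0}" and ?s = "\<lambda>h. c h - d h"
  have F: "finite ?F" and sub: "{h. ?s h \<noteq> 0} \<subseteq> ?F" and FC: "?F \<subseteq> C"
    using assms by (auto simp: fin_prob_def)
  have one: "(\<Sum>h\<in>?F. c h) = 1" "(\<Sum>h\<in>?F. d h) = 1"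
    using sum_support_superset[OF F, of c "\<lambda>_. 1"] sum_support_superset[OF F, of d "\<lambda>_. 1"] assms
    by (simp_all add: fin_prob_def)
  have s: "(\<Sum>h\<in>?F. \<bar>?s h\<bar>) \<le> 2"
  proof -
    have "(\<Sum>h\<in>?F. \<bar>?s h\<bar>) \<le> (\<Sum>h\<in>?F. c h + d h)"
      using c d by (intro sum_mono) (auto simp: fin_prob_def abs_le_iff)
    then show ?thesis by (simp add: sum.distrib one)
  qed
  obtain a where "a \<in> ?F" using one by fastforce
  then have B: "0 \<le> B" using K[of a a] FC by (auto intro: order_trans[OF abs_ge_zero])
  have "\<bar>\<Sum>i\<in>?F. \<Sum>j\<in>?F. ?s i * ?s j * K i j\<bar> \<le> (\<Sum>i\<in>?F. \<Sum>j\<in>?F. \<bar>?s i\<bar> * \<bar>?s j\<bar> * B)"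
    using FC K by (intro order_trans[OF sum_abs] sum_mono) (auto simp: abs_mult intro!: mult_left_mono)
  also have "\<dots> = (\<Sum>h\<in>?F. \<bar>?s h\<bar>) * (\<Sum>h\<in>?F. \<bar>?s h\<bar>) * B"
    unfolding sum_product by (simp add: sum_distrib_right)
  also have "\<dots> \<le> 2 * 2 * B" by (intro mult_right_mono mult_mono s B) (auto intro: sum_nonneg)
  finally show ?thesis by (subst energy_superset[OF F sub]) simp
qed

context group begin

lemma translate_support:
  assumes "g \<in> carrier G" "{h. s h \<noteq> 0} \<subseteq> carrier G"
  shows "{h. translate G g s h \<noteq> 0} = (\<lambda>h. g \<otimes> h) ` {h. s h \<noteq> 0}"
proof (intro equalityI subsetI)
  fix h assume h: "h \<in> {h. translate G g s h \<noteq> 0}"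
  then have "h = g \<otimes> (inv g \<otimes> h)" and "s (inv g \<otimes> h) \<noteq> 0"
    using assms(1) by (auto simp: translate_def m_assoc[symmetric] split: if_splits)
  then show "h \<in> (\<lambda>h. g \<otimes> h) ` {h. s h \<noteq> 0}" by blast
next
  fix h assume "h \<in> (\<lambda>h. g \<otimes> h) ` {h. s h \<noteq> 0}"
  then show "h \<in> {h. translate G g s h \<noteq> 0}"
    using assms by (auto simp: translate_def m_assoc[symmetric] subset_iff)
qed

lemma translate_apply:
  "g \<in> carrier G \<Longrightarrow> h \<in> carrier G \<Longrightarrow> translate G g s (g \<otimes> h) = s h"
  by (simp add: translate_def m_assoc[symmetric])

lemma sum_translate:
  assumes "g \<in> carrier G" "{h. s h \<noteq> 0} \<subseteq> carrier G"
  shows "(\<Sum>h | translate G g s h \<noteq> 0. f h (translate G g s h)) = (\<Sum>h | s h \<noteq> 0. f (g \<otimes> h) (s h))"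
proof -
  have "inj_on (\<lambda>h. g \<otimes> h) {h. s h \<noteq> 0}"
    using assms by (auto simp: inj_on_def subset_iff)
  then show ?thesis
    unfolding translate_support[OF assms]
    using assms by (subst sum.reindex) (auto intro!: sum.cong simp: translate_apply subset_iff)
qed

lemma translate_fin_prob:
  assumes "g \<in> carrier G" "c \<in> fin_prob (carrier G)"
  shows "translate G g c \<in> fin_prob (carrier G)"
proof -
  have sub: "{h. c h \<noteq> 0} \<subseteq> carrier G" using assms by (simp add: fin_prob_def)
  have "finite {h. translate G g c h \<noteq> 0}"
    unfolding translate_support[OF assms(1) sub] using assms(2) by (simp add: fin_prob_def)
  moreover have "(\<Sum>h | translate G g c h \<noteq> 0. translate G g c h) = 1"
    using sum_translate[OF assms(1) sub, of "\<lambda>_ x. x"] assms(2) by (simp add: fin_prob_def)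
  ultimately show ?thesis
    using assms by (auto simp: fin_prob_def translate_def split: if_splits)
qed

lemma energy_translate:
  assumes g: "g \<in> carrier G" and s: "{h. s h \<noteq> 0} \<subseteq> carrier G"
    and K: "\<And>h h'. h \<in> carrier G \<Longrightarrow> h' \<in> carrier G \<Longrightarrow> K (g \<otimes> h) (g \<otimes> h') = K h h'"
  shows "energy K (translate G g s) = energy K s"
proof -
  have "(\<Sum>i | translate G g s i \<noteq> 0. \<Sum>j | translate G g s j \<noteq> 0. translate G g s i * translate G g s j * K i j)
      = (\<Sum>i | translate G g s i \<noteq> 0. \<Sum>j | s j \<noteq> 0. translate G g s i * s j * K i (g \<otimes> j))"
    by (intro sum.cong refl sum_translate[OF g s, of "\<lambda>j x. _ * x * K _ j"])
  also have "\<dots> = (\<Sum>i | s i \<noteq> 0. \<Sum>j | s j \<noteq> 0. s i * s j * K (g \<otimes> i) (g \<otimes> j))"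
    by (rule sum_translate[OF g s, of "\<lambda>i x. \<Sum>j | s j \<noteq> 0. x * s j * K i (g \<otimes> j)"])
  also have "\<dots> = (\<Sum>i | s i \<noteq> 0. \<Sum>j | s j \<noteq> 0. s i * s j * K i j)"
    using s by (intro sum.cong refl) (auto simp: K subset_iff)
  finally show ?thesis by (simp add: energy_def)
qed

text \<open>
The circumcentre argument, for a bounded invariant kernel that behaves like a squared distance. If
the circumradii \<open>r c\<close> and \<open>r d\<close> exceed their infimum \<open>r0\<close> by little, the parallelogram law for the
midpoint forces \<open>c\<close> and \<open>d\<close> to be close in energy. Translation does not increase circumradii, so an
almost minimising \<open>c\<close> is also close to each of its translates, at a rate independent of \<open>g\<close>.
\<close>

lemma asymptotically_invariant_centres:
  fixes K :: "'a \<Rightarrow> 'a \<Rightarrow> real"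
  assumes inv: "\<And>g h h'. g \<in> carrier G \<Longrightarrow> h \<in> carrier G \<Longrightarrow> h' \<in> carrier G
      \<Longrightarrow> K (g \<otimes> h) (g \<otimes> h') = K h h'"
    and bdd: "\<And>h h'. h \<in> carrier G \<Longrightarrow> h' \<in> carrier G \<Longrightarrow> \<bar>K h h'\<bar> \<le> B"
    and pos: "\<And>s. finite {h. s h \<noteq> 0} \<Longrightarrow> {h. s h \<noteq> 0} \<subseteq> carrier G \<Longrightarrow> (\<Sum>h | s h \<noteq> 0. s h) = 0
      \<Longrightarrow> 0 \<le> energy K s"
  obtains c :: "nat \<Rightarrow> 'a \<Rightarrow> real" where "\<And>n. c n \<in> fin_prob (carrier G)"
    and "\<And>n. energy K (\<lambda>h. c (Suc n) h - c n h) \<le> (1/8)^n"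
    and "\<And>n g. g \<in> carrier G \<Longrightarrow> energy K (\<lambda>h. translate G g (c n) h - c n h) \<le> (1/8)^n"
proof -
  let ?P = "fin_prob (carrier G)"
  define r where "r c = (SUP g\<in>carrier G. energy K (\<lambda>h. c h - indicator {g} h))" for c
  define r0 where "r0 = (INF c\<in>?P. r c)"
  have bddr: "bdd_above ((\<lambda>g. energy K (\<lambda>h. c h - indicator {g} h)) ` carrier G)" if "c \<in> ?P" for c
    using energy_bound[OF that fin_prob_indicator bdd] by (intro bdd_aboveI2[where M = "2 * B"])
  have le_r: "energy K (\<lambda>h. c h - indicator {g} h) \<le> r c" if "c \<in> ?P" "g \<in> carrier G" for c g
    unfolding r_def using bddr[OF that(1)] that(2) by (rule cSUP_upper2) simp
  have posd: "0 \<le> energy K (\<lambda>h. c h - d h)" if "c \<in> ?P" "d \<in> ?P" for c d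
    using fin_prob_diff[OF that] by (intro pos)
  have "0 \<le> r c" if "c \<in> ?P" for c
    using order_trans[OF posd[OF that fin_prob_indicator[OF one_closed]] le_r[OF that one_closed]] .
  then have bddP: "bdd_below (r ` ?P)" by (auto simp: bdd_below_def)
  have r0_le: "r0 \<le> r c" if "c \<in> ?P" for c
    unfolding r0_def using bddP that by (rule cINF_lower)
  \<comment> \<open>The midpoint of c and d has circumradius at least r0.\<close>
  have close: "energy K (\<lambda>h. c h - d h) \<le> 2 * (r c + r d) - 4 * r0" if c: "c \<in> ?P" and d: "d \<in> ?P" for c d
  proof -
    let ?m = "\<lambda>h. (c h + d h) / 2"
    have "r ?m \<le> r c / 2 + r d / 2 - energy K (\<lambda>h. c h - d h) / 4"
      unfolding r_def[of ?m]
    proof (rule cSUP_least)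
      fix g assume g: "g \<in> carrier G"
      have "energy K (\<lambda>h. ?m h - indicator {g} h) =
          energy K (\<lambda>h. ((c h - indicator {g} h) + (d h - indicator {g} h)) / 2)"
        by (intro arg_cong[of _ _ "energy K"]) (auto simp: field_simps)
      also have "\<dots> = energy K (\<lambda>h. c h - indicator {g} h) / 2 + energy K (\<lambda>h. d h - indicator {g} h) / 2
          - energy K (\<lambda>h. (c h - indicator {g} h) - (d h - indicator {g} h)) / 4"
        using fin_prob_diff(1)[OF c fin_prob_indicator[OF g]] fin_prob_diff(1)[OF d fin_prob_indicator[OF g]]
        by (rule energy_parallelogram)
      also have "\<dots> \<le> r c / 2 + r d / 2 - energy K (\<lambda>h. c h - d h) / 4"
        using le_r[OF c g] le_r[OF d g] by simp
      finally show "energy K (\<lambda>h. ?m h - indicator {g} h) \<le> r c / 2 + r d / 2 - energy K (\<lambda>h. c h - d h) / 4" .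
    qed auto
    then show ?thesis using r0_le[OF fin_prob_midpoint[OF c d]] by simp
  qed
  have r_translate: "r (translate G g c) \<le> r c" if g: "g \<in> carrier G" and c: "c \<in> ?P" for g c
    unfolding r_def[of "translate G g c"]
  proof (rule cSUP_least)
    fix k assume k: "k \<in> carrier G"
    let ?k = "inv g \<otimes> k"
    have kk: "?k \<in> carrier G" using g k by simp
    have eq: "translate G g c h - indicator {k} h = translate G g (\<lambda>h. c h - indicator {?k} h) h" for h
    proof (cases "h \<in> carrier G")
      case True
      then have "h = k \<longleftrightarrow> inv g \<otimes> h = ?k" using g k by simp
      then show ?thesis using True by (simp add: translate_def indicator_def)
    qed (use k in \<open>auto simp: translate_def indicator_def\<close>)
    have "energy K (\<lambda>h. translate G g c h - indicator {k} h) = energy K (\<lambda>h. c h - indicator {?k} h)"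
      unfolding eq using fin_prob_diff(2)[OF c fin_prob_indicator[OF kk]] inv[OF g]
      by (intro energy_translate[OF g])
    then show "energy K (\<lambda>h. translate G g c h - indicator {k} h) \<le> r c" using le_r[OF c kk] by simp
  qed auto
  \<comment> \<open>The rate 1/8 leaves room for a weight 4^n in the almost everywhere argument below.\<close>
  have "\<exists>c\<in>?P. r c < r0 + (1/8)^n / 4" for n :: nat
  proof -
    have "r0 < r0 + (1/8)^n / 4" by simp
    then show ?thesis
      unfolding r0_def using fin_prob_indicator[OF one_closed] bddP
      by (subst (asm) cINF_less_iff) auto
  qed
  then obtain c where c: "\<And>n. c n \<in> ?P" and rc: "\<And>n::nat. r (c n) < r0 + (1/8)^n / 4" by metis
  show thesis
  proof (rule that[of c])
    show "energy K (\<lambda>h. c (Suc n) h - c n h) \<le> (1/8)^n" for n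
    proof -
      have "r (c (Suc n)) < r0 + (1/8) ^ n / 4"
        using rc[of "Suc n"] by (rule less_le_trans) (simp add: power_decreasing)
      then show ?thesis using close[OF c[of "Suc n"] c[of n]] rc[of n] by argo
    qed
    show "energy K (\<lambda>h. translate G g (c n) h - c n h) \<le> (1/8)^n" if "g \<in> carrier G" for n g
      using close[OF translate_fin_prob[OF that c[of n]] c[of n]] rc[of n] r_translate[OF that c[of n]] by simp
  qed (rule c)
qed

end

section \<open>Half-line indicators and limits of finite distributions on the line\<close>

text \<open>
The embedding of the line into \<open>L\<^sup>2\<close>: the squared \<open>L\<^sup>2\<close> distance of \<open>below p\<close> and \<open>below q\<close>
is \<open>\<bar>p - q\<bar>\<close>.
\<close>

abbreviation below :: "real \<Rightarrow> real \<Rightarrow> real" where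
  "below q t \<equiv> (if t < q then 1 else 0)"

text \<open>
If \<open>s\<close> is a probability distribution, this is the probability that \<open>q\<close> exceeds \<open>t\<close>.
\<close>

definition tail :: "('g \<Rightarrow> real) \<Rightarrow> ('g \<Rightarrow> real) \<Rightarrow> real \<Rightarrow> real" where
  "tail s q t = (\<Sum>h | s h \<noteq> 0. s h * below (q h) t)"

lemma below_measurable [measurable]: "below q \<in> borel_measurable borel"
  by measurable

lemma tail_measurable [measurable]: "tail s q \<in> borel_measurable borel"
  unfolding tail_def by measurable

lemma has_bochner_integral_below_diff:
  "has_bochner_integral lborel (\<lambda>t. below p t - below q t) (p - q)"
proof (cases "q \<le> p")
  case True
  have "has_bochner_integral lborel (indicator {q..<p}) (measure lborel {q..<p})"
    by (rule has_bochner_integral_real_indicator) (use True in \<open>auto simp: emeasure_lborel_Ico\<close>)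
  moreover have "(indicator {q..<p} :: real \<Rightarrow> real) = (\<lambda>t. below p t - below q t)"
    using True by (auto simp: fun_eq_iff indicator_def)
  ultimately show ?thesis using True by (simp add: measure_def emeasure_lborel_Ico)
next
  case False
  have "has_bochner_integral lborel (\<lambda>t. - indicator {p..<q} t) (- measure lborel {p..<q})"
    by (intro has_bochner_integral_minus has_bochner_integral_real_indicator) (use False in \<open>auto simp: emeasure_lborel_Ico\<close>)
  moreover have "(\<lambda>t. - indicator {p..<q} t :: real) = (\<lambda>t. below p t - below q t)"
    using False by (auto simp: fun_eq_iff indicator_def)
  ultimately show ?thesis using False by (simp add: measure_def emeasure_lborel_Ico)
qed

lemma has_bochner_integral_abs_below_diff:
  "has_bochner_integral lborel (\<lambda>t. \<bar>below p t - below q t\<bar>) \<bar>p - q\<bar>"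
proof (cases "q \<le> p")
  case True
  then have "(\<lambda>t. \<bar>below p t - below q t\<bar>) = (\<lambda>t. below p t - below q t)" by auto
  then show ?thesis using has_bochner_integral_below_diff[of p q] True by simp
next
  case False
  then have "(\<lambda>t. \<bar>below p t - below q t\<bar>) = (\<lambda>t. below q t - below p t)" by auto
  then show ?thesis using has_bochner_integral_below_diff[of q p] False by simp
qed

lemma tail_diff:
  assumes "finite {h. c h \<noteq> 0}" "finite {h. d h \<noteq> 0}"
  shows "tail (\<lambda>h. c h - d h) q t = tail c q t - tail d q t"
proof -
  let ?F = "{h. c h \<noteq> 0} \<union> {h. d h \<noteq> 0}"
  have F: "finite ?F" using assms by simp
  have "tail c q t = (\<Sum>h\<in>?F. c h * below (q h) t)" "tail d q t = (\<Sum>h\<in>?F. d h * below (q h) t)"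
    "tail (\<lambda>h. c h - d h) q t = (\<Sum>h\<in>?F. (c h - d h) * below (q h) t)"
    unfolding tail_def by (rule sum_support_superset[OF F]; auto)+
  then show ?thesis by (simp add: left_diff_distrib sum_subtractf)
qed

lemma tail_range: "c \<in> fin_prob C \<Longrightarrow> tail c q t \<in> {0..1}"
proof -
  assume c: "c \<in> fin_prob C"
  then have "tail c q t \<le> (\<Sum>h | c h \<noteq> 0. c h)"
    unfolding tail_def by (intro sum_mono) (auto simp: fin_prob_def)
  moreover have "0 \<le> tail c q t"
    using c unfolding tail_def by (intro sum_nonneg) (auto simp: fin_prob_def)
  ultimately show ?thesis using c by (simp add: fin_prob_def)
qed

text \<open>
For numbers \<open>u i\<close>, \<open>u j\<close> in \<open>{0, 1}\<close> one has \<open>\<bar>u i - u j\<bar> = u i + u j - 2 * u i * u j\<close>; the first two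
terms contribute nothing since \<open>s\<close> has sum \<open>0\<close>.
\<close>

lemma tail_square_energy:
  assumes "finite {h. s h \<noteq> 0}" "(\<Sum>h | s h \<noteq> 0. s h) = 0"
  shows "(tail s q t)\<^sup>2 = energy (\<lambda>i j. \<bar>below (q i) t - below (q j) t\<bar>) s"
proof -
  let ?S = "{h. s h \<noteq> 0}" and ?u = "\<lambda>h. below (q h) t"
  have "(\<Sum>i\<in>?S. \<Sum>j\<in>?S. s i * s j * \<bar>?u i - ?u j\<bar>) =
      (\<Sum>i\<in>?S. \<Sum>j\<in>?S. (s i * ?u i) * s j + s i * (s j * ?u j)
        - (s i * ?u i) * (s j * ?u j) - (s i * ?u i) * (s j * ?u j))"
    by (intro sum.cong refl) auto
  also have "\<dots> = (\<Sum>i\<in>?S. s i * ?u i) * (\<Sum>j\<in>?S. s j) + (\<Sum>i\<in>?S. s i) * (\<Sum>j\<in>?S. s j * ?u j)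
      - (\<Sum>i\<in>?S. s i * ?u i) * (\<Sum>j\<in>?S. s j * ?u j)
      - (\<Sum>i\<in>?S. s i * ?u i) * (\<Sum>j\<in>?S. s j * ?u j)"
    unfolding sum_product by (simp only: sum.distrib sum_subtractf)
  also have "\<dots> = - 2 * (tail s q t)\<^sup>2"
    unfolding assms(2) tail_def power2_eq_square by simp
  finally show ?thesis by (simp add: energy_def)
qed

lemma integral_tail_square:
  assumes "finite {h. s h \<noteq> 0}" "(\<Sum>h | s h \<noteq> 0. s h) = 0"
  shows "has_bochner_integral lborel (\<lambda>t. (tail s q t)\<^sup>2) (energy (\<lambda>i j. \<bar>q i - q j\<bar>) s)"
  unfolding tail_square_energy[OF assms] unfolding energy_def
  by (intro has_bochner_integral_mult_right has_bochner_integral_sum has_bochner_integral_abs_below_diff)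

lemma nn_integral_tail_square:
  assumes "finite {h. s h \<noteq> 0}" "(\<Sum>h | s h \<noteq> 0. s h) = 0"
  shows "(\<integral>\<^sup>+t. ennreal ((tail s q t)\<^sup>2) \<partial>lborel) = ennreal (energy (\<lambda>i j. \<bar>q i - q j\<bar>) s)"
  using integral_tail_square[OF assms, of q]
  by (subst nn_integral_eq_integral) (auto simp: has_bochner_integral_iff)

text \<open>
The finite distributions \<open>\<Sum>h. c n h * \<delta>(q h)\<close> on the line converge weakly to a distribution with
mean \<open>v\<close>. A distribution with tail function \<open>F\<close> has mean \<open>\<integral> (F t - 1[t < 0]) dt\<close>; this form has the
advantage that convergence of tails can be obtained from \<open>L\<^sup>2\<close> estimates.
\<close>

definition limit_mean :: "(nat \<Rightarrow> 'g \<Rightarrow> real) \<Rightarrow> ('g \<Rightarrow> real) \<Rightarrow> real \<Rightarrow> bool" where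
  "limit_mean c q v \<longleftrightarrow> (\<exists>F. (AE t in lborel. (\<lambda>n. tail (c n) q t) \<longlonglongrightarrow> F t) \<and>
     has_bochner_integral lborel (\<lambda>t. F t - below 0 t) v)"

lemma limit_mean_unique:
  assumes "limit_mean c q v" "limit_mean c' q' v'"
    and "AE t in lborel. (\<lambda>n. tail (c n) q t - tail (c' n) q' t) \<longlonglongrightarrow> 0"
  shows "v = v'"
proof -
  obtain F where F: "AE t in lborel. (\<lambda>n. tail (c n) q t) \<longlonglongrightarrow> F t"
    "has_bochner_integral lborel (\<lambda>t. F t - below 0 t) v" using assms(1) by (auto simp: limit_mean_def)
  obtain F' where F': "AE t in lborel. (\<lambda>n. tail (c' n) q' t) \<longlonglongrightarrow> F' t"
    "has_bochner_integral lborel (\<lambda>t. F' t - below 0 t) v'" using assms(2) by (auto simp: limit_mean_def)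
  have "AE t in lborel. F t = F' t"
    using F(1) F'(1) assms(3)
  proof eventually_elim
    case (elim t)
    from tendsto_diff[OF elim(1,2)] elim(3) have "F t - F' t = 0" by (rule LIMSEQ_unique)
    then show ?case by simp
  qed
  then have "(LBINT t. F t - below 0 t) = (LBINT t. F' t - below 0 t)"
    using F(2) F'(2) by (intro integral_cong_AE) (auto simp: has_bochner_integral_iff)
  then show ?thesis using F(2) F'(2) by (simp add: has_bochner_integral_iff)
qed

text \<open>
For \<open>r > 0\<close> the tails of the image under \<open>t \<mapsto> z + r * t\<close> are rescaled tails, and the mean is computed
by substitution. For \<open>r = 0\<close> all the distributions are point masses at \<open>z\<close>, whatever happens to \<open>q\<close>;
this case occurs where a density vanishes.
\<close>

lemma limit_mean_affine:
  assumes c: "\<And>n. c n \<in> fin_prob C" and lim: "0 < r \<Longrightarrow> limit_mean c q v" and r: "0 \<le> r"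
  shows "limit_mean c (\<lambda>h. z + r * q h) (z + r * v)"
proof (cases "r = 0")
  case True
  have "tail (c n) (\<lambda>h. z) t = below z t" for n t
    using c[of n] by (simp add: tail_def fin_prob_def)
  then show ?thesis using True has_bochner_integral_below_diff[of z 0]
    by (auto simp: limit_mean_def intro!: exI[of _ "below z"])
next
  case False
  with r have r: "0 < r" by simp
  obtain F where F: "AE t in lborel. (\<lambda>n. tail (c n) q t) \<longlonglongrightarrow> F t"
    "has_bochner_integral lborel (\<lambda>t. F t - below 0 t) v" using lim[OF r] by (auto simp: limit_mean_def)
  have "(\<lambda>t. F t - below 0 t) \<in> borel_measurable borel"
    using F(2) by (auto simp: has_bochner_integral_iff)
  then have "(\<lambda>t. (F t - below 0 t) + below 0 t) \<in> borel_measurable borel" by measurable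
  then have [measurable]: "F \<in> borel_measurable borel" by simp
  let ?F = "\<lambda>t. F (- z / r + (1 / r) * t)"
  have scale: "- z / r + (1 / r) * t < p \<longleftrightarrow> t < z + r * p" for t p
    using r by (simp add: field_simps)
  have tail: "tail (c n) (\<lambda>h. z + r * q h) t = tail (c n) q (- z / r + (1 / r) * t)" for n t
    unfolding tail_def scale ..
  have "AE t in lborel. (\<lambda>n. tail (c n) (\<lambda>h. z + r * q h) t) \<longlonglongrightarrow> ?F t"
    unfolding tail using r F(1) by (intro AE_borel_affine) auto
  moreover have "has_bochner_integral lborel (\<lambda>t. ?F t - below 0 t) (z + r * v)"
  proof -
    have "has_bochner_integral lborel (\<lambda>t. (\<lambda>t. F t - below 0 t) (- z / r + (1 / r) * t)) (v /\<^sub>R \<bar>1 / r\<bar>)"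
      using F(2) r by (subst lborel_has_bochner_integral_real_affine_iff[symmetric]) auto
    moreover have "v /\<^sub>R \<bar>1 / r\<bar> = r * v" using r by simp
    ultimately have "has_bochner_integral lborel (\<lambda>t. ?F t - below z t) (r * v)"
      using scale[of _ 0] r by simp
    from has_bochner_integral_add[OF this has_bochner_integral_below_diff[of z 0]]
    show ?thesis by (simp add: add.commute)
  qed
  ultimately show ?thesis by (auto simp: limit_mean_def)
qed

lemma limit_mean_cong:
  assumes "\<And>n h. c n h \<noteq> 0 \<Longrightarrow> q h = q' h" "limit_mean c q v"
  shows "limit_mean c q' v"
proof -
  have "tail (c n) q t = tail (c n) q' t" for n t
    unfolding tail_def using assms(1) by (intro sum.cong) auto
  then show ?thesis using assms(2) by (simp add: limit_mean_def)
qed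

text \<open>
For \<open>m \<ge> 0\<close> the integral is \<open>q\<close> truncated to \<open>[-m, m]\<close>.
\<close>

lemma abs_truncated_mean_le:
  "\<bar>LBINT t:{-m..m}. below q t - below 0 t\<bar> \<le> \<bar>q\<bar>"
proof -
  have i: "integrable lborel (\<lambda>t. below q t - below 0 t)"
    and ia: "integrable lborel (\<lambda>t. \<bar>below q t - below 0 t\<bar>)"
    using has_bochner_integral_below_diff has_bochner_integral_abs_below_diff
    by (auto simp: has_bochner_integral_iff)
  have "\<bar>LBINT t:{-m..m}. below q t - below 0 t\<bar> \<le> (LBINT t. \<bar>below q t - below 0 t\<bar>)"
    unfolding set_lebesgue_integral_def
  proof (rule order_trans[OF integral_abs_bound], rule integral_mono)
    show "integrable lborel (\<lambda>t. \<bar>indicator {-m..m} t *\<^sub>R (below q t - below 0 t)\<bar>)"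
      by (intro integrable_abs integrable_mult_indicator i) simp
  qed (auto intro: ia simp: indicator_def)
  also have "\<dots> = \<bar>q\<bar>"
    using has_bochner_integral_abs_below_diff[of q 0] by (simp add: has_bochner_integral_iff)
  finally show ?thesis .
qed

lemma fin_prob_sum_const: "c \<in> fin_prob C \<Longrightarrow> (\<Sum>h | c h \<noteq> 0. c h * a) = a"
  by (simp add: fin_prob_def sum_distrib_right[symmetric])

lemma tail_minus_below:
  "c \<in> fin_prob C \<Longrightarrow> tail c q t - below 0 t = (\<Sum>h | c h \<noteq> 0. c h * (below (q h) t - below 0 t))"
  using fin_prob_sum_const[of c C "below 0 t"]
  by (simp add: tail_def right_diff_distrib sum_subtractf del: mult_cancel_left1)

text \<open>
Integrability of \<open>F e - below 0\<close> is Fatou's lemma, as \<open>\<integral> \<bar>below q t - below 0 t\<bar> dt = \<bar>q\<bar>\<close>. The norm bound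
cannot be obtained in this way one coordinate at a time. Instead it is proved for the means of the
distributions truncated coordinatewise to \<open>[-m, m]\<close>: these converge as \<open>n\<close> grows, by dominated
convergence, and truncating the coordinates of a vector does not increase its Euclidean norm.
\<close>

lemma limit_mean_exists:
  fixes p :: "'g \<Rightarrow> 'k::euclidean_space"
  assumes c: "\<And>n. c n \<in> fin_prob C"
    and conv: "\<And>e. e \<in> Basis \<Longrightarrow> AE t in lborel. convergent (\<lambda>n. tail (c n) (\<lambda>h. p h \<bullet> e) t)"
    and fin: "liminf (\<lambda>n. ennreal (\<Sum>h | c n h \<noteq> 0. c n h * norm (p h))) < \<infinity>"
  defines "F e t \<equiv> lim (\<lambda>n. tail (c n) (\<lambda>h. p h \<bullet> e) t)"
  defines "v e \<equiv> LBINT t. F e t - below 0 t"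
  shows "\<And>e. e \<in> Basis \<Longrightarrow> limit_mean c (\<lambda>h. p h \<bullet> e) (v e)"
    and "ennreal (norm (\<Sum>e\<in>Basis. v e *\<^sub>R e)) \<le> liminf (\<lambda>n. ennreal (\<Sum>h | c n h \<noteq> 0. c n h * norm (p h)))"
proof -
  let ?S = "\<lambda>n. \<Sum>h | c n h \<noteq> 0. c n h * norm (p h)"
  let ?L = "liminf (\<lambda>n. ennreal (?S n))"
  have cpos: "0 \<le> c n h" for n h using c[of n] by (simp add: fin_prob_def)
  have cfin: "finite {h. c n h \<noteq> 0}" for n using c[of n] by (simp add: fin_prob_def)
  have Fm [measurable]: "F e \<in> borel_measurable borel" for e
    unfolding F_def by measurable
  have lim: "AE t in lborel. (\<lambda>n. tail (c n) (\<lambda>h. p h \<bullet> e) t) \<longlonglongrightarrow> F e t" if "e \<in> Basis" for e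
    using conv[OF that] by eventually_elim (simp add: F_def convergent_LIMSEQ_iff)
  have int: "integrable lborel (\<lambda>t. F e t - below 0 t)" if e: "e \<in> Basis" for e
  proof (rule integrableI_bounded)
    let ?q = "\<lambda>h. p h \<bullet> e"
    have bound: "(\<integral>\<^sup>+t. ennreal \<bar>tail (c n) ?q t - below 0 t\<bar> \<partial>lborel) \<le> ennreal (?S n)" for n
    proof -
      have "(\<integral>\<^sup>+t. ennreal \<bar>tail (c n) ?q t - below 0 t\<bar> \<partial>lborel)
          \<le> (\<integral>\<^sup>+t. ennreal (\<Sum>h | c n h \<noteq> 0. c n h * \<bar>below (?q h) t - below 0 t\<bar>) \<partial>lborel)"
        unfolding tail_minus_below[OF c]
        by (intro nn_integral_mono ennreal_leI order_trans[OF sum_abs])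
          (auto intro!: sum_mono simp: abs_mult cpos)
      also have "\<dots> = ennreal (\<Sum>h | c n h \<noteq> 0. c n h * \<bar>?q h - 0\<bar>)"
      proof -
        have "has_bochner_integral lborel (\<lambda>t. \<Sum>h | c n h \<noteq> 0. c n h * \<bar>below (?q h) t - below 0 t\<bar>)
            (\<Sum>h | c n h \<noteq> 0. c n h * \<bar>?q h - 0\<bar>)"
          by (intro has_bochner_integral_sum has_bochner_integral_mult_right has_bochner_integral_abs_below_diff)
        then show ?thesis
          by (subst nn_integral_eq_integral) (auto simp: has_bochner_integral_iff cpos intro!: sum_nonneg)
      qed
      also have "\<dots> \<le> ennreal (?S n)"
        using e by (intro ennreal_leI sum_mono mult_left_mono) (auto simp: cpos Basis_le_norm)
      finally show ?thesis .
    qed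
    have "(\<integral>\<^sup>+t. ennreal (norm (F e t - below 0 t)) \<partial>lborel)
        = (\<integral>\<^sup>+t. liminf (\<lambda>n. ennreal \<bar>tail (c n) ?q t - below 0 t\<bar>) \<partial>lborel)"
    proof (rule nn_integral_cong_AE)
      show "AE t in lborel. ennreal (norm (F e t - below 0 t)) = liminf (\<lambda>n. ennreal \<bar>tail (c n) ?q t - below 0 t\<bar>)"
        using lim[OF e]
      proof eventually_elim
        case (elim t)
        then have "(\<lambda>n. ennreal \<bar>tail (c n) ?q t - below 0 t\<bar>) \<longlonglongrightarrow> ennreal \<bar>F e t - below 0 t\<bar>"
          by (intro tendsto_intros)
        then show ?case using lim_imp_Liminf[OF sequentially_bot] by (metis real_norm_def)
      qed
    qed
    also have "\<dots> \<le> liminf (\<lambda>n. \<integral>\<^sup>+t. ennreal \<bar>tail (c n) ?q t - below 0 t\<bar> \<partial>lborel)"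
      by (rule nn_integral_liminf) measurable
    also have "\<dots> \<le> ?L" by (intro Liminf_mono always_eventually allI bound)
    also note fin
    finally show "(\<integral>\<^sup>+t. ennreal (norm (F e t - below 0 t)) \<partial>lborel) < \<infinity>" .
  qed measurable
  show "limit_mean c (\<lambda>h. p h \<bullet> e) (v e)" if "e \<in> Basis" for e
    using lim[OF that] int[OF that] by (auto simp: limit_mean_def v_def has_bochner_integral_iff)
  \<comment> \<open>cl m truncates a number to the interval from -m to m, un m n is the mean of the truncated
    distribution number n, and vm m is the limit of un m n.\<close>
  define cl where "cl m q = (LBINT t:{-m..m}. below q t - below 0 t)" for m q :: real
  define vm where "vm m = (\<Sum>e\<in>Basis. (LBINT t:{-m..m}. F e t - below 0 t) *\<^sub>R e)" for m :: real
  define un where "un m n = (\<Sum>e\<in>Basis. (\<Sum>h | c n h \<noteq> 0. c n h * cl m (p h \<bullet> e)) *\<^sub>R e)" for m n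
  have norm_un: "norm (un m n) \<le> ?S n" for m n
  proof -
    have "un m n = (\<Sum>h | c n h \<noteq> 0. c n h *\<^sub>R (\<Sum>e\<in>Basis. cl m (p h \<bullet> e) *\<^sub>R e))"
      unfolding un_def scaleR_sum_left scaleR_sum_right by (subst sum.swap) simp
    also have "norm \<dots> \<le> ?S n"
    proof (rule order_trans[OF norm_sum], rule sum_mono)
      fix h
      have "norm (\<Sum>e\<in>Basis. cl m (p h \<bullet> e) *\<^sub>R e) \<le> norm (p h)"
        unfolding norm_eq_sqrt_inner[of "p h"] norm_eq_sqrt_inner[of "sum _ _"]
        by (rule real_sqrt_le_mono, subst (1 2) euclidean_inner)
          (auto intro!: sum_mono simp: power2_eq_square[symmetric] cl_def abs_le_square_iff[symmetric] abs_truncated_mean_le)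
      then show "norm (c n h *\<^sub>R (\<Sum>e\<in>Basis. cl m (p h \<bullet> e) *\<^sub>R e)) \<le> c n h * norm (p h)"
        by (simp add: cpos mult_left_mono)
    qed
    finally show ?thesis .
  qed
  have un_lim: "(\<lambda>n. un m n) \<longlonglongrightarrow> vm m" for m
    unfolding un_def vm_def
  proof (intro tendsto_intros)
    fix e :: 'k assume e: "e \<in> Basis"
    let ?q = "\<lambda>h. p h \<bullet> e"
    have "(\<Sum>h | c n h \<noteq> 0. c n h * cl m (?q h)) = (LBINT t:{-m..m}. tail (c n) ?q t - below 0 t)" for n
    proof -
      have "has_bochner_integral lborel (\<lambda>t. indicator {-m..m} t *\<^sub>R (below q t - below 0 t)) (cl m q)" for q
        using has_bochner_integral_below_diff[of q 0]
        by (auto simp: cl_def set_lebesgue_integral_def has_bochner_integral_iff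
            intro!: integrable_mult_indicator simp del: real_scaleR_def)
      then have "has_bochner_integral lborel
          (\<lambda>t. \<Sum>h | c n h \<noteq> 0. c n h * (indicator {-m..m} t *\<^sub>R (below (?q h) t - below 0 t)))
          (\<Sum>h | c n h \<noteq> 0. c n h * cl m (?q h))"
        by (intro has_bochner_integral_sum has_bochner_integral_mult_right)
      also have "(\<lambda>t. \<Sum>h | c n h \<noteq> 0. c n h * (indicator {-m..m} t *\<^sub>R (below (?q h) t - below 0 t)))
          = (\<lambda>t. indicator {-m..m} t *\<^sub>R (tail (c n) ?q t - below 0 t))"
        unfolding tail_minus_below[OF c] by (simp add: sum_distrib_left mult_ac)
      finally show ?thesis by (simp add: set_lebesgue_integral_def has_bochner_integral_iff)
    qed
    moreover have "(\<lambda>n. LBINT t:{-m..m}. tail (c n) ?q t - below 0 t) \<longlonglongrightarrow> (LBINT t:{-m..m}. F e t - below 0 t)"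
      unfolding set_lebesgue_integral_def
    proof (rule integral_dominated_convergence)
      show "integrable lborel (indicator {-m..m} :: real \<Rightarrow> real)"
        by (rule integrable_real_indicator) (auto simp: emeasure_lborel_Icc_eq)
      show "AE t in lborel. (\<lambda>n. indicator {-m..m} t *\<^sub>R (tail (c n) ?q t - below 0 t))
          \<longlonglongrightarrow> indicator {-m..m} t *\<^sub>R (F e t - below 0 t)"
        using lim[OF e] by eventually_elim (intro tendsto_intros)
      show "AE t in lborel. norm (indicator {-m..m} t *\<^sub>R (tail (c n) ?q t - below 0 t)) \<le> indicator {-m..m} t" for n
      proof (rule AE_I2)
        fix t
        show "norm (indicator {-m..m} t *\<^sub>R (tail (c n) ?q t - below 0 t)) \<le> indicator {-m..m} t"
          using tail_range[OF c[of n], of ?q t] by (auto simp: indicator_def)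
      qed
    qed auto
    ultimately show "(\<lambda>n. \<Sum>h | c n h \<noteq> 0. c n h * cl m (?q h)) \<longlonglongrightarrow> (LBINT t:{-m..m}. F e t - below 0 t)"
      by simp
  qed
  have norm_vm: "ennreal (norm (vm m)) \<le> ?L" for m
  proof -
    have "(\<lambda>n. ennreal (norm (un m n))) \<longlonglongrightarrow> ennreal (norm (vm m))"
      using un_lim[of m] by (intro tendsto_intros)
    then have "ennreal (norm (vm m)) = liminf (\<lambda>n. ennreal (norm (un m n)))"
      using lim_imp_Liminf[OF sequentially_bot] by metis
    also have "\<dots> \<le> ?L" by (intro Liminf_mono always_eventually allI ennreal_leI norm_un)
    finally show ?thesis .
  qed
  have "(\<lambda>m. vm (real m)) \<longlonglongrightarrow> (\<Sum>e\<in>Basis. v e *\<^sub>R e)"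
    unfolding vm_def
  proof (intro tendsto_intros)
    fix e :: 'k assume e: "e \<in> Basis"
    show "(\<lambda>m. LBINT t:{- real m..real m}. F e t - below 0 t) \<longlonglongrightarrow> v e"
      unfolding set_lebesgue_integral_def v_def
    proof (rule integral_dominated_convergence)
      show "integrable lborel (\<lambda>t. \<bar>F e t - below 0 t\<bar>)" using int[OF e] by (rule integrable_abs)
      show "AE t in lborel. (\<lambda>m. indicator {- real m..real m} t *\<^sub>R (F e t - below 0 t)) \<longlonglongrightarrow> F e t - below 0 t"
      proof (intro AE_I2 tendsto_eventually)
        fix t :: real
        show "\<forall>\<^sub>F m in sequentially. indicator {- real m..real m} t *\<^sub>R (F e t - below 0 t) = F e t - below 0 t"
          using eventually_ge_at_top[of "nat \<lceil>\<bar>t\<bar>\<rceil>"]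
          by eventually_elim (auto simp: indicator_def abs_le_iff nat_le_iff ceiling_le_iff)
      qed
    qed (auto simp: indicator_def)
  qed
  then have "(\<lambda>m. ennreal (norm (vm (real m)))) \<longlonglongrightarrow> ennreal (norm (\<Sum>e\<in>Basis. v e *\<^sub>R e))"
    by (intro tendsto_intros)
  then show "ennreal (norm (\<Sum>e\<in>Basis. v e *\<^sub>R e)) \<le> ?L"
    by (rule LIMSEQ_le_const2) (auto intro: norm_vm)
qed

section \<open>The variation of a measure\<close>

definition sigma_additive :: "'x topology \<Rightarrow> ('x set \<Rightarrow> 'k::{real_normed_field, euclidean_space}) \<Rightarrow> bool" where
  "sigma_additive X \<mu> \<longleftrightarrow> (\<forall>A. A \<notin> borel_sets_of X \<longrightarrow> \<mu> A = 0) \<and>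
     (\<forall>A :: nat \<Rightarrow> 'x set. range A \<subseteq> borel_sets_of X \<longrightarrow> disjoint_family A \<longrightarrow>
        (\<lambda>i. \<mu> (A i)) sums \<mu> (\<Union>i. A i))"

lemma sigma_algebra_borel_sets_of: "sigma_algebra (topspace X) (borel_sets_of X)"
  unfolding borel_sets_of_def by (rule sigma_algebra_sigma_sets) (auto dest: openin_subset)

lemma space_borel:
  assumes "sets M = borel_sets_of X" shows "space M = topspace X"
proof -
  interpret sigma_algebra "topspace X" "borel_sets_of X" by (rule sigma_algebra_borel_sets_of)
  show ?thesis using sets.top[of M] sets.sets_into_space[of "topspace X" M] top space_closed assms by auto
qed

lemma
  shows borel_sets_of_empty: "{} \<in> borel_sets_of X"
    and borel_sets_of_space: "topspace X \<in> borel_sets_of X"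
    and borel_sets_of_Un: "A \<in> borel_sets_of X \<Longrightarrow> B \<in> borel_sets_of X \<Longrightarrow> A \<union> B \<in> borel_sets_of X"
    and borel_sets_of_Diff: "A \<in> borel_sets_of X \<Longrightarrow> B \<in> borel_sets_of X \<Longrightarrow> A - B \<in> borel_sets_of X"
    and borel_sets_of_Int: "A \<in> borel_sets_of X \<Longrightarrow> B \<in> borel_sets_of X \<Longrightarrow> A \<inter> B \<in> borel_sets_of X"
    and borel_sets_of_UN: "countable I \<Longrightarrow> (\<And>i. i \<in> I \<Longrightarrow> C i \<in> borel_sets_of X)
      \<Longrightarrow> (\<Union>i\<in>I. C i) \<in> borel_sets_of X"
proof -
  interpret sigma_algebra "topspace X" "borel_sets_of X" by (rule sigma_algebra_borel_sets_of)
  show "{} \<in> borel_sets_of X" "topspace X \<in> borel_sets_of X" by simp_all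
  show "A \<union> B \<in> borel_sets_of X" "A - B \<in> borel_sets_of X" "A \<inter> B \<in> borel_sets_of X"
    if "A \<in> borel_sets_of X" "B \<in> borel_sets_of X" using that by (rule Un Diff Int)+
  show "(\<Union>i\<in>I. C i) \<in> borel_sets_of X" if "countable I" "\<And>i. i \<in> I \<Longrightarrow> C i \<in> borel_sets_of X"
    using that by (intro countable_UN'') auto
qed

lemma compactin_borel:
  assumes "Hausdorff_space X" "compactin X K" shows "K \<in> borel_sets_of X"
proof -
  have "closedin X K" using assms by (rule compactin_imp_closedin)
  then have "openin X (topspace X - K)" "K \<subseteq> topspace X" by (auto simp: closedin_def)
  then have "topspace X - K \<in> borel_sets_of X"
    unfolding borel_sets_of_def by (intro sigma_sets.Basic) simp
  then have "topspace X - (topspace X - K) \<in> borel_sets_of X" by (rule borel_sets_of_Diff[OF borel_sets_of_space])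
  also have "topspace X - (topspace X - K) = K" using \<open>K \<subseteq> topspace X\<close> by auto
  finally show ?thesis .
qed

lemma sigma_additive_empty: "sigma_additive X \<mu> \<Longrightarrow> \<mu> {} = 0"
proof -
  assume \<mu>: "sigma_additive X \<mu>"
  have "range (\<lambda>_::nat. {}) \<subseteq> borel_sets_of X" "disjoint_family (\<lambda>_::nat. {})"
    by (auto simp: disjoint_family_on_def borel_sets_of_empty)
  then have "(\<lambda>i::nat. \<mu> {}) sums \<mu> (\<Union>i::nat. {})"
    using \<mu> unfolding sigma_additive_def by blast
  then have "summable (\<lambda>i::nat. \<mu> {})" by (rule sums_summable)
  then show ?thesis by (simp add: summable_const_iff)
qed

text \<open>
Families are more convenient than partitions: they may have empty members and need not exhaust \<open>A\<close>.
\<close>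

lemma sum_norm_le_variation:
  assumes \<mu>: "\<mu> {} = 0" and I: "finite I" "disjoint_family_on C I" and C: "C ` I \<subseteq> borel_sets_of X"
    and A: "(\<Union>i\<in>I. C i) \<subseteq> A" "A \<in> borel_sets_of X"
  shows "(\<Sum>i\<in>I. ennreal (norm (\<mu> (C i)))) \<le> variation X \<mu> A"
proof -
  let ?J = "{i\<in>I. C i \<noteq> {}}" and ?P = "insert (A - (\<Union>i\<in>I. C i)) (C ` I) - {{}}"
  have inj: "inj_on C ?J"
  proof (rule inj_onI, rule ccontr)
    fix i j assume "i \<in> ?J" "j \<in> ?J" "C i = C j" "i \<noteq> j"
    with disjoint_family_onD[OF I(2), of i j] show False by auto
  qed
  have UC: "(\<Union>i\<in>I. C i) \<in> borel_sets_of X" using I(1) C by (intro borel_sets_of_UN) (auto intro: countable_finite)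
  have sub: "?P \<subseteq> borel_sets_of X" using C borel_sets_of_Diff[OF A(2) UC] by blast
  have part: "partition_on A ?P"
  proof (rule partition_onI)
    show "\<Union>?P = A"
    proof (intro equalityI subsetI)
      fix x assume "x \<in> \<Union>?P"
      then obtain p where "p \<in> ?P" "x \<in> p" by (rule UnionE)
      then show "x \<in> A" using A(1) by blast
    next
      fix x assume x: "x \<in> A"
      show "x \<in> \<Union>?P"
      proof (cases "x \<in> (\<Union>i\<in>I. C i)")
        case True
        then obtain i where "i \<in> I" "x \<in> C i" by (rule UN_E)
        then show ?thesis by (intro UnionI[of "C i"]) auto
      next
        case False
        then show ?thesis using x by (intro UnionI[of "A - (\<Union>i\<in>I. C i)"]) auto
      qed
    qed
    have CC: "disjnt (C i) (C j)" if "i \<in> I" "j \<in> I" "C i \<noteq> C j" for i j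
      using that disjoint_family_onD[OF I(2), of i j] by (auto simp: disjnt_def)
    have CA: "disjnt (C i) (A - (\<Union>i\<in>I. C i))" "disjnt (A - (\<Union>i\<in>I. C i)) (C i)" if "i \<in> I" for i
      using that by (auto simp: disjnt_def)
    show "disjnt p q" if "p \<in> ?P" "q \<in> ?P" "p \<noteq> q" for p q
    proof -
      from that have "p = A - (\<Union>i\<in>I. C i) \<or> p \<in> C ` I" "q = A - (\<Union>i\<in>I. C i) \<or> q \<in> C ` I" by blast+
      then show ?thesis using \<open>p \<noteq> q\<close> CC CA by (elim disjE imageE) simp_all
    qed
  qed simp
  have "(\<Sum>i\<in>I. ennreal (norm (\<mu> (C i)))) = (\<Sum>i\<in>?J. ennreal (norm (\<mu> (C i))))"
    by (rule sum.mono_neutral_right) (use I(1) \<mu> in auto)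
  also have "\<dots> = (\<Sum>B\<in>C ` ?J. ennreal (norm (\<mu> B)))"
    by (simp add: sum.reindex[OF inj])
  also have "\<dots> \<le> (\<Sum>B\<in>?P. ennreal (norm (\<mu> B)))"
    by (rule sum_mono2) (use I(1) in auto)
  also have "\<dots> \<le> variation X \<mu> A"
  proof -
    have "finite ?P" using I(1) by simp
    then have "?P \<in> {P. finite P \<and> P \<subseteq> borel_sets_of X \<and> partition_on A P}"
      using sub part by blast
    then show ?thesis unfolding variation_def by (rule SUP_upper)
  qed
  finally show ?thesis .
qed

lemma variation_le:
  assumes "\<And>P. finite P \<Longrightarrow> P \<subseteq> borel_sets_of X \<Longrightarrow> partition_on A P
      \<Longrightarrow> (\<Sum>B\<in>P. ennreal (norm (\<mu> B))) \<le> c"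
  shows "variation X \<mu> A \<le> c"
  unfolding variation_def using assms by (intro SUP_least) auto

lemma norm_le_variation:
  assumes "\<mu> {} = 0" "A \<in> borel_sets_of X" "B \<in> borel_sets_of X" "B \<subseteq> A"
  shows "ennreal (norm (\<mu> B)) \<le> variation X \<mu> A"
  using sum_norm_le_variation[of \<mu> "{()}" "\<lambda>_. B" X A] assms by (simp add: disjoint_family_on_def)

lemma variation_superadditive:
  assumes \<mu>: "\<mu> {} = 0" and A: "A \<in> borel_sets_of X" "B \<in> borel_sets_of X" "A \<inter> B = {}"
  shows "variation X \<mu> A + variation X \<mu> B \<le> variation X \<mu> (A \<union> B)"
proof -
  let ?\<P> = "\<lambda>A. {P. finite P \<and> P \<subseteq> borel_sets_of X \<and> partition_on A P}"
  let ?s = "\<lambda>P. \<Sum>B\<in>P. ennreal (norm (\<mu> B))"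
  have ne: "?\<P> A \<noteq> {}" if "A \<in> borel_sets_of X" for A
  proof -
    have "{A} - {{}} \<in> ?\<P> A" using that by (auto simp: partition_on_def disjoint_def)
    then show ?thesis by blast
  qed
  have step: "?s P + ?s Q \<le> variation X \<mu> (A \<union> B)" if P: "P \<in> ?\<P> A" and Q: "Q \<in> ?\<P> B" for P Q
  proof -
    have PQ: "\<Union>P = A" "\<Union>Q = B" "{} \<notin> P" "{} \<notin> Q" using P Q by (auto simp: partition_on_def)
    have "P \<inter> Q = {}"
    proof (intro equals0I)
      fix p assume p: "p \<in> P \<inter> Q"
      then obtain x where "x \<in> p" using PQ(3) by (metis IntD1 ex_in_conv)
      with p PQ(1,2) A(3) show False by blast
    qed
    then have "?s P + ?s Q = ?s (P \<union> Q)" using P Q by (simp add: sum.union_disjoint del: sum_ennreal)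
    also have "\<dots> \<le> variation X \<mu> (A \<union> B)"
      unfolding variation_def
    proof (rule SUP_upper)
      have "disjoint (P \<union> Q)"
        using P Q A(3) PQ by (intro disjoint_union) (auto simp: partition_on_def)
      then show "P \<union> Q \<in> ?\<P> (A \<union> B)" using P Q PQ by (auto simp: partition_on_def)
    qed
    finally show ?thesis .
  qed
  have "?s P + variation X \<mu> B \<le> variation X \<mu> (A \<union> B)" if "P \<in> ?\<P> A" for P
    unfolding variation_def[of X \<mu> B] ennreal_SUP_add_right[OF ne[OF A(2)]]
    by (intro SUP_least step that)
  then show ?thesis
    unfolding variation_def[of X \<mu> A] ennreal_SUP_add_left[OF ne[OF A(1)], symmetric]
    by (intro SUP_least)
qed

lemma variation_mono:
  assumes \<mu>: "\<mu> {} = 0" and A: "A \<in> borel_sets_of X" "B \<in> borel_sets_of X" "A \<subseteq> B"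
  shows "variation X \<mu> A \<le> variation X \<mu> B"
proof -
  have "variation X \<mu> A \<le> variation X \<mu> A + variation X \<mu> (B - A)" by simp
  also have "\<dots> \<le> variation X \<mu> (A \<union> (B - A))"
    using A by (intro variation_superadditive \<mu> borel_sets_of_Diff) auto
  also have "A \<union> (B - A) = B" using A by auto
  finally show ?thesis .
qed

text \<open>
One inequality is finite superadditivity. For the other, cut each member of a partition of the union
along the sets \<open>A i\<close> and use \<open>\<sigma>\<close>-additivity of \<open>\<mu>\<close> inside the norm.
\<close>

lemma countably_additive_variation:
  assumes "sigma_additive X \<mu>"
  shows "countably_additive (borel_sets_of X) (variation X \<mu>)"
proof (rule countably_additiveI)
  note \<mu> = sigma_additive_empty[OF assms]
  fix A :: "nat \<Rightarrow> 'a set"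
  assume A: "range A \<subseteq> borel_sets_of X" "disjoint_family A" "(\<Union>i. A i) \<in> borel_sets_of X"
  let ?V = "variation X \<mu>"
  show "(\<Sum>i. ?V (A i)) = ?V (\<Union>i. A i)"
  proof (rule antisym)
    have "(\<Sum>i<n. ?V (A i)) \<le> ?V (\<Union>i<n. A i)" for n
    proof (induction n)
      case (Suc n)
      have "(\<Sum>i<Suc n. ?V (A i)) \<le> ?V (\<Union>i<n. A i) + ?V (A n)"
        using Suc by (simp add: add_right_mono)
      also have "\<dots> \<le> ?V ((\<Union>i<n. A i) \<union> A n)"
      proof (intro variation_superadditive \<mu> borel_sets_of_UN)
        have "A i \<inter> A n = {}" if "i < n" for i
          using disjoint_family_onD[OF A(2), of i n] that by simp
        then show "(\<Union>i<n. A i) \<inter> A n = {}" by auto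
      qed (use A(1) in auto)
      finally show ?case by (simp add: lessThan_Suc Un_commute)
    qed simp
    also have "?V (\<Union>i<n. A i) \<le> ?V (\<Union>i. A i)" for n
      using A by (intro variation_mono \<mu> borel_sets_of_UN) auto
    finally show "(\<Sum>i. ?V (A i)) \<le> ?V (\<Union>i. A i)"
      by (intro suminf_le_const) auto
  next
    show "?V (\<Union>i. A i) \<le> (\<Sum>i. ?V (A i))"
    proof (rule variation_le)
      fix P assume P: "finite P" "P \<subseteq> borel_sets_of X" "partition_on (\<Union>i. A i) P"
      have "ennreal (norm (\<mu> B)) \<le> (\<Sum>i. ennreal (norm (\<mu> (B \<inter> A i))))" if B: "B \<in> P" for B
      proof -
        have "(\<lambda>i. \<mu> (B \<inter> A i)) sums \<mu> (\<Union>i. B \<inter> A i)"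
        proof -
          have "range (\<lambda>i. B \<inter> A i) \<subseteq> borel_sets_of X" "disjoint_family (\<lambda>i. B \<inter> A i)"
            using A P B by (auto simp: disjoint_family_on_def intro!: borel_sets_of_Int)
          then show ?thesis using assms unfolding sigma_additive_def by blast
        qed
        moreover have "(\<Union>i. B \<inter> A i) = B" using P(3) B by (auto simp: partition_on_def)
        ultimately have s: "(\<lambda>n. \<Sum>i<n. \<mu> (B \<inter> A i)) \<longlonglongrightarrow> \<mu> B" by (simp add: sums_def)
        have "(\<lambda>n. ennreal (norm (\<Sum>i<n. \<mu> (B \<inter> A i)))) \<longlonglongrightarrow> ennreal (norm (\<mu> B))"
          using s by (intro tendsto_intros)
        then show ?thesis
        proof (rule LIMSEQ_le_const2, intro exI allI impI)
          fix n
          have "ennreal (norm (\<Sum>i<n. \<mu> (B \<inter> A i))) \<le> ennreal (\<Sum>i<n. norm (\<mu> (B \<inter> A i)))"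
            by (intro ennreal_leI norm_sum)
          also have "\<dots> = (\<Sum>i<n. ennreal (norm (\<mu> (B \<inter> A i))))" by simp
          also have "\<dots> \<le> (\<Sum>i. ennreal (norm (\<mu> (B \<inter> A i))))" by (rule sum_le_suminf) auto
          finally show "ennreal (norm (\<Sum>i<n. \<mu> (B \<inter> A i))) \<le> (\<Sum>i. ennreal (norm (\<mu> (B \<inter> A i))))" .
        qed
      qed
      then have "(\<Sum>B\<in>P. ennreal (norm (\<mu> B))) \<le> (\<Sum>B\<in>P. \<Sum>i. ennreal (norm (\<mu> (B \<inter> A i))))"
        by (rule sum_mono)
      also have "\<dots> = (\<Sum>i. \<Sum>B\<in>P. ennreal (norm (\<mu> (B \<inter> A i))))"
        by (rule suminf_sum[symmetric]) simp
      also have "\<dots> \<le> (\<Sum>i. ?V (A i))"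
      proof (rule suminf_le)
        fix i
        show "(\<Sum>B\<in>P. ennreal (norm (\<mu> (B \<inter> A i)))) \<le> ?V (A i)"
        proof (rule sum_norm_le_variation)
          have "disjoint_family_on (\<lambda>B. B) P"
            using P(3) by (auto simp: disjoint_family_on_def partition_on_def disjoint_def)
          then show "disjoint_family_on (\<lambda>B. B \<inter> A i) P"
            by (rule disjoint_family_on_bisimulation) auto
        qed (use \<mu> P(1,2) A(1) in \<open>auto intro!: borel_sets_of_Int\<close>)
      qed auto
      finally show "(\<Sum>B\<in>P. ennreal (norm (\<mu> B))) \<le> (\<Sum>i. ?V (A i))" .
    qed
  qed
qed

definition variation_measure :: "'x topology \<Rightarrow> ('x set \<Rightarrow> 'k::{real_normed_field, euclidean_space}) \<Rightarrow> 'x measure" where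
  "variation_measure X \<mu> = measure_of (topspace X) (borel_sets_of X) (variation X \<mu>)"

lemma sets_variation_measure: "sets (variation_measure X \<mu>) = borel_sets_of X"
proof -
  interpret sigma_algebra "topspace X" "borel_sets_of X" by (rule sigma_algebra_borel_sets_of)
  show ?thesis unfolding variation_measure_def by simp
qed

lemma emeasure_variation_measure:
  assumes "sigma_additive X \<mu>" "A \<in> borel_sets_of X"
  shows "emeasure (variation_measure X \<mu>) A = variation X \<mu> A"
  unfolding variation_measure_def
proof (rule emeasure_measure_of_sigma[OF sigma_algebra_borel_sets_of _ countably_additive_variation[OF assms(1)] assms(2)])
  have "variation X \<mu> {} \<le> 0"
  proof (rule variation_le)
    fix P :: "'a set set" assume "partition_on {} P"
    then have "P = {}" by (auto simp: partition_on_def)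
    then show "(\<Sum>B\<in>P. ennreal (norm (\<mu> B))) \<le> 0" by simp
  qed
  then show "positive (borel_sets_of X) (variation X \<mu>)" by (simp add: positive_def)
qed


section \<open>Indefinite integrals and densities\<close>

definition indefinite_integral ::
    "'x topology \<Rightarrow> 'x measure \<Rightarrow> ('x \<Rightarrow> 'k::{real_normed_field, euclidean_space}) \<Rightarrow> 'x set \<Rightarrow> 'k" where
  "indefinite_integral X M f A = (if A \<in> borel_sets_of X then LINT x:A|M. f x else 0)"

lemma set_integrable_of_integrable:
  fixes f :: "'a \<Rightarrow> 'b::{banach, second_countable_topology}"
  shows "integrable M f \<Longrightarrow> A \<in> sets M \<Longrightarrow> set_integrable M A f"
  unfolding set_integrable_def by (rule integrable_mult_indicator)

lemma sigma_additive_indefinite_integral: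
  assumes M: "sets M = borel_sets_of X" and f: "integrable M f"
  shows "sigma_additive X (indefinite_integral X M f)"
  unfolding sigma_additive_def
proof (intro conjI allI impI)
  fix A :: "nat \<Rightarrow> 'a set" assume A: "range A \<subseteq> borel_sets_of X" "disjoint_family A"
  have "(\<lambda>n. LINT x:(\<Union>i<n. A i)|M. f x) \<longlonglongrightarrow> (LINT x:(\<Union>n. \<Union>i<n. A i)|M. f x)"
    using A M f by (intro set_integral_cont_up set_integrable_of_integrable)
      (auto simp: incseq_def intro!: borel_sets_of_UN intro: less_le_trans)
  moreover have "(\<Union>n. \<Union>i<n. A i) = (\<Union>i. A i)" by auto
  moreover have "(LINT x:(\<Union>i<n. A i)|M. f x) = (\<Sum>i<n. LINT x:A i|M. f x)" for n
    using A M f by (intro set_integral_finite_Union set_integrable_of_integrable)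
      (auto simp: disjoint_family_on_def)
  ultimately have "(\<lambda>i. LINT x:A i|M. f x) sums (LINT x:(\<Union>i. A i)|M. f x)" by (simp add: sums_def)
  moreover have "A i \<in> borel_sets_of X" "(\<Union>i. A i) \<in> borel_sets_of X" for i
    using A by (auto intro!: borel_sets_of_UN)
  ultimately show "(\<lambda>i. indefinite_integral X M f (A i)) sums indefinite_integral X M f (\<Union>i. A i)"
    by (simp add: indefinite_integral_def)
qed (simp add: indefinite_integral_def)

lemma variation_indefinite_integral_le:
  assumes M: "sets M = borel_sets_of X" and f: "integrable M f" and A: "A \<in> borel_sets_of X"
  shows "variation X (indefinite_integral X M f) A \<le> emeasure (density M (\<lambda>x. ennreal (norm (f x)))) A"
proof (rule variation_le)
  fix P assume P: "finite P" "P \<subseteq> borel_sets_of X" "partition_on A P"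
  let ?N = "density M (\<lambda>x. ennreal (norm (f x)))"
  have "ennreal (norm (indefinite_integral X M f B)) \<le> emeasure ?N B" if "B \<in> P" for B
  proof -
    have B: "B \<in> sets M" using that P M by auto
    have i: "integrable M (\<lambda>x. indicator B x *\<^sub>R f x)" using B f by (rule integrable_mult_indicator)
    have "ennreal (norm (indefinite_integral X M f B)) \<le> ennreal (\<integral>x. norm (indicator B x *\<^sub>R f x) \<partial>M)"
      using B M integral_norm_bound[of M "\<lambda>x. indicator B x *\<^sub>R f x"]
      by (simp add: indefinite_integral_def set_lebesgue_integral_def ennreal_leI del: norm_scaleR)
    also have "\<dots> = (\<integral>\<^sup>+x. ennreal (norm (indicator B x *\<^sub>R f x)) \<partial>M)"
      by (rule nn_integral_eq_integral[OF integrable_norm[OF i], symmetric]) simp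
    also have "\<dots> = emeasure ?N B"
      using B f by (subst emeasure_density) (auto intro!: nn_integral_cong simp: indicator_def)
    finally show ?thesis .
  qed
  then have "(\<Sum>B\<in>P. ennreal (norm (indefinite_integral X M f B))) \<le> (\<Sum>B\<in>P. emeasure ?N B)"
    by (rule sum_mono)
  also have "\<dots> = emeasure ?N (\<Union>B\<in>P. B)"
    using P M by (intro sum_emeasure) (auto simp: partition_on_def disjoint_family_on_def disjoint_def)
  also have "(\<Union>B\<in>P. B) = A" using P(3) by (auto simp: partition_on_def)
  finally show "(\<Sum>B\<in>P. ennreal (norm (indefinite_integral X M f B))) \<le> emeasure ?N A" .
qed

text \<open>
The lower bound for the variation uses the partition into the level sets of a simple function close
to \<open>f\<close>: on such a set the norm of the integral of the simple function is the integral of its norm.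
\<close>

lemma tv_norm_indefinite_integral:
  fixes f :: "'x \<Rightarrow> 'k::{real_normed_field, euclidean_space}"
  assumes M: "sets M = borel_sets_of X" "finite_measure M" and f: "integrable M f"
  shows "tv_norm X (indefinite_integral X M f) = (\<integral>\<^sup>+x. ennreal (norm (f x)) \<partial>M)"
proof (rule antisym)
  interpret finite_measure M by fact
  note space_M = space_borel[OF M(1)]
  let ?\<mu> = "indefinite_integral X M f"
  have "emeasure (density M (\<lambda>x. ennreal (norm (f x)))) (space M) = (\<integral>\<^sup>+x. ennreal (norm (f x)) \<partial>M)"
    using f by (subst emeasure_density) (auto intro!: nn_integral_cong)
  then show "tv_norm X ?\<mu> \<le> (\<integral>\<^sup>+x. ennreal (norm (f x)) \<partial>M)"
    unfolding tv_norm_def using variation_indefinite_integral_le[OF M(1) f borel_sets_of_space] by (simp add: space_M)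
  obtain s where "\<forall>i. simple_function M (s i)" "\<forall>x\<in>space M. (\<lambda>i. s i x) \<longlonglongrightarrow> f x"
      "\<forall>i. \<forall>x\<in>space M. dist (s i x) 0 \<le> 2 * dist (f x) 0"
    using borel_measurable_implies_sequence_metric[OF borel_measurable_integrable[OF f], of 0] by blast
  then have s: "\<And>i. simple_function M (s i)" "\<And>x. x \<in> space M \<Longrightarrow> (\<lambda>i. s i x) \<longlonglongrightarrow> f x"
      "\<And>i x. x \<in> space M \<Longrightarrow> norm (s i x) \<le> 2 * norm (f x)" by simp_all
  have s_meas [measurable]: "s i \<in> borel_measurable M" for i
    using s(1) by (rule borel_measurable_simple_function)
  have f_meas [measurable]: "f \<in> borel_measurable M" using f by auto
  have int_s: "integrable M (s i)" for i
    by (rule Bochner_Integration.integrable_bound[of M "\<lambda>x. 2 * norm (f x)"]) (use f s(3) in auto)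
  have int_d: "integrable M (\<lambda>x. norm (s i x - f x))" for i
    using int_s f by (intro integrable_norm Bochner_Integration.integrable_diff)
  have "(\<lambda>i. \<integral>x. norm (s i x - f x) \<partial>M) \<longlonglongrightarrow> (\<integral>x. 0 \<partial>M)"
  proof (rule integral_dominated_convergence)
    show "integrable M (\<lambda>x. 3 * norm (f x))" using f by auto
    show "AE x in M. (\<lambda>i. norm (s i x - f x)) \<longlonglongrightarrow> 0"
      using s(2) by (intro AE_I2) (auto intro!: tendsto_norm_zero simp: LIM_zero_iff)
    show "AE x in M. norm (norm (s i x - f x)) \<le> 3 * norm (f x)" for i
    proof (rule AE_I2)
      fix x assume "x \<in> space M"
      from s(3)[OF this, of i] norm_triangle_ineq4[of "s i x" "f x"]
      show "norm (norm (s i x - f x)) \<le> 3 * norm (f x)" by simp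
    qed
  qed auto
  then have lim: "(\<lambda>i. ennreal ((\<integral>x. norm (f x) \<partial>M) - 2 * (\<integral>x. norm (s i x - f x) \<partial>M)))
      \<longlonglongrightarrow> ennreal ((\<integral>x. norm (f x) \<partial>M) - 2 * 0)"
    by (intro tendsto_intros) simp
  have le: "ennreal ((\<integral>x. norm (f x) \<partial>M) - 2 * (\<integral>x. norm (s i x - f x) \<partial>M)) \<le> tv_norm X ?\<mu>" for i
  proof -
    define C where "C y = s i -` {y} \<inter> space M" for y
    let ?I = "s i ` space M"
    have fin: "finite ?I" using s(1) by (rule simple_functionD)
    have C: "C y \<in> sets M" for y unfolding C_def by measurable
    have disj: "disjoint_family_on C ?I" by (auto simp: disjoint_family_on_def C_def)
    have UC: "(\<Union>y\<in>?I. C y) = space M" by (auto simp: C_def)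
    have split: "(\<Sum>y\<in>?I. LINT x:C y|M. g x) = (\<integral>x. g x \<partial>M)" if "integrable M g" for g :: "'x \<Rightarrow> real"
    proof -
      have "(\<Sum>y\<in>?I. LINT x:C y|M. g x) = (LINT x:(\<Union>y\<in>?I. C y)|M. g x)"
        using that C disj fin by (intro set_integral_finite_Union[symmetric] set_integrable_of_integrable)
      then show ?thesis
        unfolding UC using that by (simp add: set_integral_space)
    qed
    have each: "(LINT x:C y|M. norm (s i x)) - (LINT x:C y|M. norm (s i x - f x)) \<le> norm (?\<mu> (C y))" for y
    proof -
      have "(LINT x:C y|M. norm (s i x)) = (LINT x:C y|M. norm y)"
        by (rule set_lebesgue_integral_cong) (auto simp: C C_def)
      also have "\<dots> = norm (LINT x:C y|M. y)"
        using C[of y] by (simp add: set_integral_const emeasure_finite)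
      also have "(LINT x:C y|M. y) = (LINT x:C y|M. s i x)"
        by (rule set_lebesgue_integral_cong) (auto simp: C C_def)
      also have "\<dots> = (LINT x:C y|M. f x) + (LINT x:C y|M. s i x - f x)"
        using C[of y] int_s[of i] f by (subst set_integral_diff) (auto intro: set_integrable_of_integrable)
      also have "norm \<dots> \<le> norm (LINT x:C y|M. f x) + norm (LINT x:C y|M. s i x - f x)"
        by (rule norm_triangle_ineq)
      also have "norm (LINT x:C y|M. s i x - f x) \<le> (LINT x:C y|M. norm (s i x - f x))"
        using C[of y] int_s[of i] f by (intro set_integral_norm_bound set_integrable_of_integrable) auto
      finally show ?thesis using C[of y] M(1) by (simp add: indefinite_integral_def)
    qed
    have "(\<integral>x. norm (f x) \<partial>M) \<le> (\<integral>x. norm (s i x) + norm (s i x - f x) \<partial>M)"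
    proof (rule integral_mono)
      show "norm (f x) \<le> norm (s i x) + norm (s i x - f x)" for x
        using norm_triangle_ineq4[of "s i x" "s i x - f x"] by simp
    qed (use f int_s int_d in auto)
    also have "\<dots> = (\<integral>x. norm (s i x) \<partial>M) + (\<integral>x. norm (s i x - f x) \<partial>M)"
      using int_s int_d by (intro Bochner_Integration.integral_add) auto
    finally have "(\<integral>x. norm (f x) \<partial>M) - 2 * (\<integral>x. norm (s i x - f x) \<partial>M)
        \<le> (\<integral>x. norm (s i x) \<partial>M) - (\<integral>x. norm (s i x - f x) \<partial>M)" by simp
    also have "\<dots> = (\<Sum>y\<in>?I. (LINT x:C y|M. norm (s i x)) - (LINT x:C y|M. norm (s i x - f x)))"
      using split[of "\<lambda>x. norm (s i x)"] split[OF int_d] int_s by (simp add: sum_subtractf)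
    also have "\<dots> \<le> (\<Sum>y\<in>?I. norm (?\<mu> (C y)))" by (intro sum_mono each)
    finally have "ennreal ((\<integral>x. norm (f x) \<partial>M) - 2 * (\<integral>x. norm (s i x - f x) \<partial>M))
        \<le> (\<Sum>y\<in>?I. ennreal (norm (?\<mu> (C y))))" by (simp add: ennreal_leI)
    also have "\<dots> \<le> tv_norm X ?\<mu>"
      unfolding tv_norm_def
    proof (rule sum_norm_le_variation)
      show "?\<mu> {} = 0" by (rule sigma_additive_empty[OF sigma_additive_indefinite_integral[OF M(1) f]])
    qed (use fin disj C UC M(1) space_M borel_sets_of_space in auto)
    finally show ?thesis .
  qed
  have "(\<integral>\<^sup>+x. ennreal (norm (f x)) \<partial>M) = ennreal ((\<integral>x. norm (f x) \<partial>M) - 2 * 0)"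
    using f by (subst nn_integral_eq_integral) auto
  also have "\<dots> \<le> tv_norm X ?\<mu>" by (rule LIMSEQ_le_const2[OF lim]) (auto intro: le)
  finally show "(\<integral>\<^sup>+x. ennreal (norm (f x)) \<partial>M) \<le> tv_norm X ?\<mu>" .
qed

text \<open>
Approximation by compact sets inside every Borel set: for a finite measure this is the Radon condition.
\<close>

definition tight :: "'x topology \<Rightarrow> 'x measure \<Rightarrow> bool" where
  "tight X M \<longleftrightarrow> (\<forall>A\<in>borel_sets_of X. \<forall>e>0. \<exists>K. compactin X K \<and> K \<subseteq> A \<and> measure M (A - K) < e)"

lemma radon_measures_iff:
  "\<mu> \<in> radon_measures X \<longleftrightarrow> sigma_additive X \<mu> \<and>
     (\<forall>A\<in>borel_sets_of X. \<forall>e>0. \<exists>K. compactin X K \<and> K \<subseteq> A \<and> variation X \<mu> (A - K) < e)"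
  by (simp add: radon_measures_def sigma_additive_def)

lemma finite_measure_variation_measure:
  assumes "sigma_additive X \<mu>" "tv_norm X \<mu> < \<infinity>"
  shows "finite_measure (variation_measure X \<mu>)"
proof (rule finite_measureI)
  show "emeasure (variation_measure X \<mu>) (space (variation_measure X \<mu>)) \<noteq> \<infinity>"
    using assms by (simp add: space_borel[OF sets_variation_measure] emeasure_variation_measure
        borel_sets_of_space tv_norm_def)
qed

lemma tight_variation_measure:
  assumes X: "Hausdorff_space X" and \<mu>: "\<mu> \<in> radon_measures X"
  shows "tight X (variation_measure X \<mu>)"
  unfolding tight_def
proof (intro ballI allI impI)
  fix A and e :: real assume A: "A \<in> borel_sets_of X" and e: "0 < e"
  have sa: "sigma_additive X \<mu>" using \<mu> by (simp add: radon_measures_iff)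
  have "0 < ennreal e" using e by simp
  then obtain K where K: "compactin X K" "K \<subseteq> A" "variation X \<mu> (A - K) < ennreal e"
    using \<mu> A unfolding radon_measures_iff by meson
  have "A - K \<in> borel_sets_of X" using A compactin_borel[OF X K(1)] by (rule borel_sets_of_Diff)
  then have less: "emeasure (variation_measure X \<mu>) (A - K) < ennreal e"
    using K(3) sa by (simp add: emeasure_variation_measure)
  then have "emeasure (variation_measure X \<mu>) (A - K) = ennreal (measure (variation_measure X \<mu>) (A - K))"
    by (intro emeasure_eq_ennreal_measure) auto
  then have "measure (variation_measure X \<mu>) (A - K) < e"
    using less by (simp add: ennreal_less_iff)
  with K show "\<exists>K. compactin X K \<and> K \<subseteq> A \<and> measure (variation_measure X \<mu>) (A - K) < e" by blast
qed

text \<open>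
The measure is \<open>\<Sum>i. 2^-(i+1) * N i\<close>. For tightness, the uniform bound makes the tail of the series
small, and finitely many compact sets can be united.
\<close>

lemma exists_dominating_measure:
  fixes N :: "nat \<Rightarrow> 'x measure"
  assumes X: "Hausdorff_space X"
    and N: "\<And>i. sets (N i) = borel_sets_of X" "\<And>i. finite_measure (N i)"
    and C: "\<And>i. measure (N i) (topspace X) \<le> C"
  obtains M where "sets M = borel_sets_of X" "finite_measure M" "\<And>i. absolutely_continuous M (N i)"
    "(\<And>i. tight X (N i)) \<Longrightarrow> tight X M"
proof -
  define m where "m A = (\<Sum>i. ennreal ((1/2)^Suc i) * emeasure (N i) A)" for A
  define M where "M = measure_of (topspace X) (borel_sets_of X) m"
  have sets_M: "sets M = borel_sets_of X"
    unfolding M_def using sigma_algebra.sets_measure_of_eq[OF sigma_algebra_borel_sets_of] .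
  have m: "emeasure M A = m A" if "A \<in> borel_sets_of X" for A
    unfolding M_def
  proof (rule emeasure_measure_of_sigma[OF sigma_algebra_borel_sets_of _ _ that])
    show "positive (borel_sets_of X) m" by (simp add: positive_def m_def)
    show "countably_additive (borel_sets_of X) m"
    proof (rule countably_additiveI)
      fix A :: "nat \<Rightarrow> 'x set" assume A: "range A \<subseteq> borel_sets_of X" "disjoint_family A"
      have "(\<Sum>j. m (A j)) = (\<Sum>i. \<Sum>j. ennreal ((1/2)^Suc i) * emeasure (N i) (A j))"
        using nn_integral_suminf[of "\<lambda>i j. ennreal ((1/2)^Suc i) * emeasure (N i) (A j)" "count_space UNIV"]
        by (simp add: m_def nn_integral_count_space_nat del: power_Suc ennreal_suminf_cmult)
      also have "\<dots> = m (\<Union>j. A j)"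
        unfolding m_def using A N(1) by (simp add: suminf_emeasure del: power_Suc)
      finally show "(\<Sum>j. m (A j)) = m (\<Union>j. A j)" .
    qed
  qed
  have meas_le: "measure (N i) A \<le> C" for i A
    using finite_measure.bounded_measure[OF N(2), of i A] C[of i] space_borel[OF N(1)] by simp
  have summ: "summable (\<lambda>i. (1/2)^Suc i * C)" for C :: real
    by (intro summable_mult2 sums_summable[OF power_half_series])
  have sm: "summable (\<lambda>i. (1/2)^Suc i * measure (N i) A)" for A
    by (rule summable_comparison_test'[OF summ[of C], of 0]) (simp add: meas_le del: power_Suc)
  have "m A = ennreal (\<Sum>i. (1/2)^Suc i * measure (N i) A)" for A
  proof -
    have "m A = (\<Sum>i. ennreal ((1/2)^Suc i * measure (N i) A))"
      unfolding m_def finite_measure.emeasure_eq_measure[OF N(2)] by (simp add: ennreal_mult del: power_Suc)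
    also have "\<dots> = ennreal (\<Sum>i. (1/2)^Suc i * measure (N i) A)"
      using sm[of A] by (intro suminf_ennreal_eq summable_sums) auto
    finally show ?thesis .
  qed
  note m_real = this
  have meas_M: "measure M A = (\<Sum>i. (1/2)^Suc i * measure (N i) A)" if "A \<in> borel_sets_of X" for A
    using m[OF that] m_real[of A] sm[of A] by (simp add: measure_def[of M] suminf_nonneg del: power_Suc)
  have fin: "finite_measure M"
    by (rule finite_measureI) (simp add: space_borel[OF sets_M] m borel_sets_of_space m_real)
  have ac: "absolutely_continuous M (N i)" for i
    unfolding absolutely_continuous_def
  proof
    fix A assume "A \<in> null_sets M"
    then have A: "A \<in> borel_sets_of X" "m A = 0" using m sets_M by (auto simp: null_sets_def)
    have "ennreal ((1/2)^Suc i) * emeasure (N i) A \<le> m A"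
      unfolding m_def using sum_le_suminf[of "\<lambda>i. ennreal ((1/2)^Suc i) * emeasure (N i) A" "{i}"]
      by (simp del: power_Suc)
    then have "emeasure (N i) A = 0" using A(2) by (simp del: power_Suc)
    then show "A \<in> null_sets (N i)" using A(1) N(1) by (auto simp: null_sets_def)
  qed
  have tight: "tight X M" if t: "\<And>i. tight X (N i)"
    unfolding tight_def
  proof (intro ballI allI impI)
    fix A and e :: real assume A: "A \<in> borel_sets_of X" and e: "0 < e"
    obtain n where n: "norm (\<Sum>i. (1/2)^Suc (i + n) * C) < e / 2"
      using suminf_exist_split[OF _ summ[of C], of "e/2"] e by auto
    have "\<forall>i. \<exists>K. compactin X K \<and> K \<subseteq> A \<and> measure (N i) (A - K) < e / 2"
      using t A e unfolding tight_def by (meson half_gt_zero)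
    then obtain K where K: "\<And>i. compactin X (K i)" "\<And>i. K i \<subseteq> A" "\<And>i. measure (N i) (A - K i) < e / 2"
      by metis
    let ?K = "\<Union>i<n. K i"
    have cK: "compactin X ?K" using K(1) by (intro compactin_Union) auto
    have Kb: "A - K i \<in> borel_sets_of X" for i
      using A compactin_borel[OF X K(1)] by (rule borel_sets_of_Diff)
    have AK: "A - ?K \<in> borel_sets_of X" using A compactin_borel[OF X cK] by (rule borel_sets_of_Diff)
    let ?t = "\<lambda>i. (1/2)^Suc i * measure (N i) (A - ?K)"
    have "(\<Sum>i<n. ?t i) \<le> (\<Sum>i<n. (1/2)^Suc i * (e / 2))"
    proof (intro sum_mono mult_left_mono)
      fix i assume "i \<in> {..<n}"
      then have "measure (N i) (A - ?K) \<le> measure (N i) (A - K i)"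
        using Kb N by (intro finite_measure.finite_measure_mono) auto
      then show "measure (N i) (A - ?K) \<le> e / 2" using K(3)[of i] by simp
    qed simp
    also have "\<dots> \<le> (\<Sum>i. (1/2)^Suc i * (e / 2))"
      using summ[of "e/2"] e by (intro sum_le_suminf) auto
    also have "\<dots> = e / 2" using sums_mult2[OF power_half_series, of "e/2"] by (simp add: sums_iff)
    finally have 1: "(\<Sum>i<n. ?t i) \<le> e / 2" .
    have "(\<Sum>i. ?t (i + n)) \<le> (\<Sum>i. (1/2)^Suc (i + n) * C)"
    proof (rule suminf_le)
      show "summable (\<lambda>i. ?t (i + n))" using sm[of "A - ?K"] by (subst summable_iff_shift)
      show "summable (\<lambda>i. (1/2)^Suc (i + n) * C)"
        using summ[of C] summable_iff_shift[of "\<lambda>i. (1/2)^Suc i * C" n] by blast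
      show "?t (i + n) \<le> (1/2)^Suc (i + n) * C" for i
        by (intro mult_left_mono meas_le) simp
    qed
    also have "\<dots> < e / 2" using n by (simp add: abs_less_iff del: power_Suc)
    finally have 2: "(\<Sum>i. ?t (i + n)) < e / 2" .
    have "measure M (A - ?K) = (\<Sum>i. ?t (i + n)) + (\<Sum>i<n. ?t i)"
      unfolding meas_M[OF AK] by (rule suminf_split_initial_segment[OF sm])
    then have "measure M (A - ?K) < e" using 1 2 by simp
    moreover have "?K \<subseteq> A" using K(2) by auto
    ultimately show "\<exists>K. compactin X K \<and> K \<subseteq> A \<and> measure M (A - K) < e" using cK by blast
  qed
  show thesis using that[OF sets_M fin ac tight] .
qed

lemma Radon_Nikodym_finite:
  assumes "finite_measure M" "finite_measure N" "sets N = sets M" "absolutely_continuous M N"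
  obtains D :: "'a \<Rightarrow> real" where "integrable M D" "\<And>x. 0 \<le> D x" "N = density M (\<lambda>x. ennreal (D x))"
    "\<And>A. A \<in> sets M \<Longrightarrow> measure N A = (LINT x:A|M. D x)"
proof -
  interpret M: finite_measure M by fact
  interpret N: finite_measure N by fact
  obtain D where D: "D \<in> borel_measurable M" "AE x in M. RN_deriv M N x = ennreal (D x)" "\<And>x. 0 \<le> D x"
    using M.real_RN_deriv[OF assms(2,4,3)] by metis
  have "density M (\<lambda>x. ennreal (D x)) = density M (RN_deriv M N)"
    using D by (intro density_cong) auto
  then have N: "N = density M (\<lambda>x. ennreal (D x))" using M.density_RN_deriv[OF assms(4,3)] by simp
  have nn: "(\<integral>\<^sup>+x. ennreal (indicator A x * D x) \<partial>M) = ennreal (measure N A)" if "A \<in> sets M" for A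
  proof -
    have "ennreal (measure N A) = emeasure N A" by (simp add: N.emeasure_eq_measure)
    also have "\<dots> = (\<integral>\<^sup>+x. ennreal (D x) * indicator A x \<partial>M)"
      using that D(1) by (subst N) (simp add: emeasure_density)
    also have "\<dots> = (\<integral>\<^sup>+x. ennreal (indicator A x * D x) \<partial>M)"
      by (intro nn_integral_cong) (auto simp: indicator_def)
    finally show ?thesis by simp
  qed
  have int: "integrable M D"
  proof (rule integrableI_bounded)
    have "(\<integral>\<^sup>+x. ennreal (norm (D x)) \<partial>M) = (\<integral>\<^sup>+x. ennreal (indicator (space M) x * D x) \<partial>M)"
      using D(3) by (intro nn_integral_cong) auto
    then show "(\<integral>\<^sup>+x. ennreal (norm (D x)) \<partial>M) < \<infinity>" using nn[of "space M"] by simp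
  qed (rule D(1))
  have "measure N A = (LINT x:A|M. D x)" if "A \<in> sets M" for A
  proof -
    have "(LINT x:A|M. D x) = enn2real (\<integral>\<^sup>+x. ennreal (indicator A x * D x) \<partial>M)"
      unfolding set_lebesgue_integral_def using that D
      by (subst integral_eq_nn_integral) auto
    then show ?thesis using nn[OF that] by simp
  qed
  then show thesis using that[OF int D(3) N] by blast
qed

text \<open>
The vector measure \<open>\<mu>\<close> is dominated by its variation \<open>V\<close>. Hence \<open>\<mu> A \<bullet> e + V A\<close> is a positive measure for
each coordinate \<open>e\<close>, and subtracting the density of \<open>V\<close> from its Radon-Nikodym density gives
the density of that coordinate of \<open>\<mu>\<close>.
\<close>

lemma exists_density:
  fixes \<mu> :: "'x set \<Rightarrow> 'k::{real_normed_field, euclidean_space}"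
  assumes \<mu>: "sigma_additive X \<mu>" "tv_norm X \<mu> < \<infinity>"
    and M: "sets M = borel_sets_of X" "finite_measure M"
    and ac: "absolutely_continuous M (variation_measure X \<mu>)"
  obtains f where "integrable M f" "\<mu> = indefinite_integral X M f"
proof -
  define V where "V = variation_measure X \<mu>"
  have sV: "sets V = borel_sets_of X" by (simp add: V_def sets_variation_measure)
  interpret M: finite_measure M by fact
  interpret V: finite_measure V unfolding V_def by (rule finite_measure_variation_measure[OF \<mu>])
  have bound: "norm (\<mu> A) \<le> measure V A" if "A \<in> borel_sets_of X" for A
  proof -
    have "ennreal (norm (\<mu> A)) \<le> emeasure V A"
      using norm_le_variation[where \<mu> = \<mu>, OF sigma_additive_empty[OF \<mu>(1)] that that] emeasure_variation_measure[OF \<mu>(1) that]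
      by (simp add: V_def)
    then show ?thesis by (simp add: V.emeasure_eq_measure)
  qed
  obtain DV where DV: "integrable M DV" "\<And>A. A \<in> sets M \<Longrightarrow> measure V A = (LINT x:A|M. DV x)"
    by (rule Radon_Nikodym_finite[OF M(2) V.finite_measure_axioms]) (use sV M(1) ac in \<open>simp_all add: V_def\<close>)
  have "\<exists>D. integrable M D \<and> (\<forall>A\<in>sets M. \<mu> A \<bullet> e + measure V A = (LINT x:A|M. D x))" if e: "e \<in> Basis" for e
  proof -
    define n where "n A = ennreal (\<mu> A \<bullet> e + measure V A)" for A
    define N where "N = measure_of (topspace X) (borel_sets_of X) n"
    have pos: "0 \<le> \<mu> A \<bullet> e + measure V A" if "A \<in> borel_sets_of X" for A
      using bound[OF that] Basis_le_norm[OF e, of "\<mu> A"] by (simp add: abs_le_iff)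
    have sN: "sets N = borel_sets_of X"
      unfolding N_def using sigma_algebra.sets_measure_of_eq[OF sigma_algebra_borel_sets_of] .
    have n: "emeasure N A = n A" if "A \<in> borel_sets_of X" for A
      unfolding N_def
    proof (rule emeasure_measure_of_sigma[OF sigma_algebra_borel_sets_of _ _ that])
      show "positive (borel_sets_of X) n"
        using sigma_additive_empty[OF \<mu>(1)] by (simp add: positive_def n_def)
      show "countably_additive (borel_sets_of X) n"
      proof (rule countably_additiveI)
        fix A :: "nat \<Rightarrow> 'x set" assume A: "range A \<subseteq> borel_sets_of X" "disjoint_family A"
        have "(\<lambda>i. \<mu> (A i)) sums \<mu> (\<Union>i. A i)"
          using \<mu>(1) A unfolding sigma_additive_def by blast
        then have "(\<lambda>i. \<mu> (A i) \<bullet> e) sums (\<mu> (\<Union>i. A i) \<bullet> e)"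
          by (rule bounded_linear.sums[OF bounded_linear_inner_left])
        moreover have "(\<lambda>i. measure V (A i)) sums measure V (\<Union>i. A i)"
          using A sV by (intro V.finite_measure_UNION) auto
        ultimately have "(\<lambda>i. \<mu> (A i) \<bullet> e + measure V (A i)) sums (\<mu> (\<Union>i. A i) \<bullet> e + measure V (\<Union>i. A i))"
          by (rule sums_add)
        then show "(\<Sum>i. n (A i)) = n (\<Union>i. A i)"
          unfolding n_def using A pos by (intro suminf_ennreal_eq) auto
      qed
    qed
    have fN: "finite_measure N"
      by (rule finite_measureI) (simp add: space_borel[OF sN] n borel_sets_of_space n_def)
    have acN: "absolutely_continuous M N"
      unfolding absolutely_continuous_def
    proof
      fix A assume A: "A \<in> null_sets M"
      then have Ab: "A \<in> borel_sets_of X" using M(1) by auto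
      have "A \<in> null_sets V" using A ac by (auto simp: absolutely_continuous_def V_def)
      then have "measure V A = 0" by (simp add: measure_def null_sets_def)
      then have "n A = 0" using bound[OF Ab] by (simp add: n_def)
      then show "A \<in> null_sets N" using Ab n sN by (simp add: null_sets_def)
    qed
    obtain D where "integrable M D" "\<And>A. A \<in> sets M \<Longrightarrow> measure N A = (LINT x:A|M. D x)"
      by (rule Radon_Nikodym_finite[OF M(2) fN]) (use sN M(1) acN in simp_all)
    moreover have "measure N A = \<mu> A \<bullet> e + measure V A" if "A \<in> sets M" for A
      using that M(1) n pos by (simp add: measure_def[of N] n_def)
    ultimately show ?thesis by auto
  qed
  then obtain D where D: "\<And>e. e \<in> Basis \<Longrightarrow> integrable M (D e)"
    "\<And>e A. e \<in> Basis \<Longrightarrow> A \<in> sets M \<Longrightarrow> \<mu> A \<bullet> e + measure V A = (LINT x:A|M. D e x)"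
    by metis
  define f where "f x = (\<Sum>e\<in>Basis. (D e x - DV x) *\<^sub>R e)" for x
  have f: "integrable M f" unfolding f_def using D(1) DV(1) by auto
  have "\<mu> A = indefinite_integral X M f A" for A
  proof (cases "A \<in> borel_sets_of X")
    case True
    then have A: "A \<in> sets M" using M(1) by simp
    have "(LINT x:A|M. f x) \<bullet> e = \<mu> A \<bullet> e" if e: "e \<in> Basis" for e
    proof -
      have "(LINT x:A|M. f x) \<bullet> e = (LINT x:A|M. f x \<bullet> e)"
        using set_integrable_of_integrable[OF f A] unfolding set_lebesgue_integral_def set_integrable_def
        by (subst integral_inner_left[symmetric]) auto
      also have "\<dots> = (LINT x:A|M. D e x - DV x)"
        using e by (simp add: f_def)
      also have "\<dots> = (LINT x:A|M. D e x) - (LINT x:A|M. DV x)"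
        using A D(1)[OF e] DV(1) by (intro set_integral_diff set_integrable_of_integrable)
      also have "\<dots> = \<mu> A \<bullet> e" using D(2)[OF e A] DV(2)[OF A] by simp
      finally show ?thesis .
    qed
    then have "(LINT x:A|M. f x) = \<mu> A" by (rule euclidean_eqI)
    then show ?thesis using True by (simp add: indefinite_integral_def)
  next
    case False
    then show ?thesis using \<mu>(1) by (simp add: sigma_additive_def indefinite_integral_def)
  qed
  then show thesis using that[OF f] by auto
qed

text \<open>
The variation is dominated by the finite measure with density \<open>norm (f x)\<close>, which is continuous along
the decreasing sequence \<open>A - L j\<close>, and the limit of that sequence is a null set of \<open>M\<close>.
\<close>

lemma radon_indefinite_integral:
  assumes X: "Hausdorff_space X" and M: "sets M = borel_sets_of X" "finite_measure M" "tight X M"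
    and f: "integrable M f"
  shows "indefinite_integral X M f \<in> radon_measures X"
  unfolding radon_measures_iff
proof (intro conjI ballI allI impI)
  interpret finite_measure M by fact
  show "sigma_additive X (indefinite_integral X M f)"
    using M(1) f by (rule sigma_additive_indefinite_integral)
  fix A and e :: ennreal assume A: "A \<in> borel_sets_of X" and e: "0 < e"
  let ?N = "density M (\<lambda>x. ennreal (norm (f x)))"
  have "\<forall>j::nat. \<exists>K. compactin X K \<and> K \<subseteq> A \<and> measure M (A - K) < inverse (real (Suc j))"
  proof
    fix j :: nat
    have "0 < inverse (real (Suc j))" by simp
    then show "\<exists>K. compactin X K \<and> K \<subseteq> A \<and> measure M (A - K) < inverse (real (Suc j))"
      using M(3) A unfolding tight_def by blast
  qed
  then obtain K where K: "\<And>j. compactin X (K j)" "\<And>j. K j \<subseteq> A" "\<And>j. measure M (A - K j) < inverse (real (Suc j))"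
    by metis
  define L where "L j = (\<Union>i<Suc j. K i)" for j
  have cL: "compactin X (L j)" for j unfolding L_def using K(1) by (intro compactin_Union) auto
  have AK: "A - K j \<in> sets M" "A - L j \<in> sets M" for j
    using M(1) borel_sets_of_Diff[OF A compactin_borel[OF X K(1)]] borel_sets_of_Diff[OF A compactin_borel[OF X cL]]
    by auto
  have "(\<Inter>j. A - L j) \<in> null_sets M"
  proof -
    have I: "(\<Inter>j. A - L j) \<in> sets M" using AK(2) by (intro sets.countable_INT) auto
    have "measure M (\<Inter>j. A - L j) \<le> inverse (real (Suc j))" for j
    proof -
      have "K j \<subseteq> L j" by (auto simp: L_def)
      then have "(\<Inter>j. A - L j) \<subseteq> A - K j" by auto
      then have "measure M (\<Inter>j. A - L j) \<le> measure M (A - K j)"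
        using AK(1) by (rule finite_measure_mono)
      then show ?thesis using K(3)[of j] by simp
    qed
    then have "measure M (\<Inter>j. A - L j) \<le> 0"
      by (intro LIMSEQ_le_const[OF LIMSEQ_inverse_real_of_nat]) auto
    then have "measure M (\<Inter>j. A - L j) = 0" using measure_nonneg[of M] by (simp add: order_antisym)
    then show ?thesis using I by (simp add: null_sets_def emeasure_eq_measure)
  qed
  moreover have "absolutely_continuous M ?N" using f by (intro absolutely_continuousI_density) auto
  ultimately have null: "emeasure ?N (\<Inter>j. A - L j) = 0" by (auto simp: absolutely_continuous_def null_sets_def)
  have "emeasure ?N B < \<infinity>" for B
  proof -
    have "emeasure ?N B \<le> emeasure ?N (space ?N)" by (rule emeasure_space)
    also have "\<dots> = (\<integral>\<^sup>+x. ennreal (norm (f x)) \<partial>M)"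
      using f by (subst emeasure_density) (auto intro!: nn_integral_cong)
    also have "\<dots> < \<infinity>" using f by (simp add: integrable_iff_bounded)
    finally show ?thesis .
  qed
  then have "(\<lambda>j. emeasure ?N (A - L j)) \<longlonglongrightarrow> emeasure ?N (\<Inter>j. A - L j)"
    using AK(2) by (intro Lim_emeasure_decseq) (auto simp: decseq_def L_def less_top)
  then have "eventually (\<lambda>j. emeasure ?N (A - L j) < e) sequentially"
    using e unfolding null by (rule order_tendstoD)
  then obtain j where "emeasure ?N (A - L j) < e" by (auto simp: eventually_sequentially)
  moreover have "variation X (indefinite_integral X M f) (A - L j) \<le> emeasure ?N (A - L j)"
    using M(1) f AK(2) by (intro variation_indefinite_integral_le) auto
  moreover have "L j \<subseteq> A" unfolding L_def using K(2) by (intro UN_least)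
  ultimately show "\<exists>K. compactin X K \<and> K \<subseteq> A \<and> variation X (indefinite_integral X M f) (A - K) < e"
    using cL by (intro exI[of _ "L j"]) auto
qed

text \<open>
The set \<open>S\<close> is enumerated, possibly with repetitions, and the variations are dominated
simultaneously. Outside \<open>S\<close> the densities are set to \<open>0\<close>, to be measurable everywhere.
\<close>

lemma exists_common_density:
  fixes \<mu> :: "'i \<Rightarrow> 'x set \<Rightarrow> 'k::{real_normed_field, euclidean_space}"
  assumes X: "Hausdorff_space X" and S: "countable S" "S \<noteq> {}"
    and \<mu>: "\<And>i. i \<in> S \<Longrightarrow> \<mu> i \<in> radon_measures X" "\<And>i. i \<in> S \<Longrightarrow> tv_norm X (\<mu> i) \<le> R" "R < \<infinity>"
  obtains M f where "sets M = borel_sets_of X" "finite_measure M" "tight X M"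
    "\<And>i. integrable M (f i)" "\<And>i. i \<in> S \<Longrightarrow> \<mu> i = indefinite_integral X M (f i)"
proof -
  let ?N = "\<lambda>j. variation_measure X (\<mu> (from_nat_into S j))"
  note mem = from_nat_into[OF S(2)]
  have sa: "sigma_additive X (\<mu> i)" if "i \<in> S" for i using \<mu>(1)[OF that] by (simp add: radon_measures_iff)
  have fin: "tv_norm X (\<mu> i) < \<infinity>" if "i \<in> S" for i using \<mu>(2)[OF that] \<mu>(3) by (rule le_less_trans)
  have bound: "measure (?N j) (topspace X) \<le> enn2real R" for j
    using \<mu>(2)[OF mem] \<mu>(3) sa[OF mem]
    by (auto simp: measure_def emeasure_variation_measure borel_sets_of_space tv_norm_def intro!: enn2real_mono)
  obtain M where M: "sets M = borel_sets_of X" "finite_measure M" "\<And>j. absolutely_continuous M (?N j)"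
    "(\<And>j. tight X (?N j)) \<Longrightarrow> tight X M"
    using exists_dominating_measure[of X ?N "enn2real R", OF X sets_variation_measure
        finite_measure_variation_measure[OF sa[OF mem] fin[OF mem]] bound] by blast
  have "tight X M" by (intro M(4) tight_variation_measure[OF X] \<mu>(1) mem)
  have "\<exists>f. integrable M f \<and> \<mu> i = indefinite_integral X M f" if i: "i \<in> S" for i
  proof -
    obtain j where "from_nat_into S j = i" using from_nat_into_surj[OF S(1) i] by blast
    then have "absolutely_continuous M (variation_measure X (\<mu> i))" using M(3)[of j] by simp
    then show ?thesis using exists_density[OF sa[OF i] fin[OF i] M(1,2)] by metis
  qed
  then obtain f where "\<And>i. i \<in> S \<Longrightarrow> integrable M (f i) \<and> \<mu> i = indefinite_integral X M (f i)" by metis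
  then show thesis
    using that[OF M(1,2) \<open>tight X M\<close>, of "\<lambda>i. if i \<in> S then f i else (\<lambda>_. 0)"] by simp
qed

lemma indefinite_integral_density:
  fixes f :: "'x \<Rightarrow> 'k::{real_normed_field, euclidean_space}" and D :: "'x \<Rightarrow> real"
  assumes M: "sets M = borel_sets_of X" and D: "D \<in> borel_measurable M" "\<And>x. 0 \<le> D x"
    and f: "integrable (density M (\<lambda>x. ennreal (D x))) f"
  shows "integrable M (\<lambda>x. D x *\<^sub>R f x)"
    and "indefinite_integral X (density M (\<lambda>x. ennreal (D x))) f = indefinite_integral X M (\<lambda>x. D x *\<^sub>R f x)"
proof -
  have [measurable]: "f \<in> borel_measurable M" using f by auto
  note [measurable] = D(1)
  show "integrable M (\<lambda>x. D x *\<^sub>R f x)"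
    using f D by (subst (asm) integrable_density) auto
  show "indefinite_integral X (density M (\<lambda>x. ennreal (D x))) f = indefinite_integral X M (\<lambda>x. D x *\<^sub>R f x)"
  proof
    fix A
    have "(LINT x:A|density M (\<lambda>x. ennreal (D x)). f x) = (LINT x:A|M. D x *\<^sub>R f x)" if "A \<in> borel_sets_of X"
    proof -
      have [measurable]: "A \<in> sets M" using that M by simp
      show ?thesis unfolding set_lebesgue_integral_def
        using D by (subst integral_density) (auto simp: mult.commute)
    qed
    then show "indefinite_integral X (density M (\<lambda>x. ennreal (D x))) f A = indefinite_integral X M (\<lambda>x. D x *\<^sub>R f x) A"
      by (simp add: indefinite_integral_def)
  qed
qed

lemma indefinite_integral_add:
  assumes "sets M = borel_sets_of X" "integrable M f" "integrable M g"
  shows "(\<lambda>A. indefinite_integral X M f A + indefinite_integral X M g A) = indefinite_integral X M (\<lambda>x. f x + g x)"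
  using assms by (auto simp: indefinite_integral_def fun_eq_iff set_integral_add set_integrable_of_integrable)

lemma indefinite_integral_diff:
  assumes "sets M = borel_sets_of X" "integrable M f" "integrable M g"
  shows "(\<lambda>A. indefinite_integral X M f A - indefinite_integral X M g A) = indefinite_integral X M (\<lambda>x. f x - g x)"
  using assms by (auto simp: indefinite_integral_def fun_eq_iff set_integral_diff set_integrable_of_integrable)

lemma indefinite_integral_inner:
  fixes f :: "'x \<Rightarrow> 'k::{real_normed_field, euclidean_space}"
  assumes "sets M = borel_sets_of X" "integrable M f"
  shows "(\<lambda>A. indefinite_integral X M f A \<bullet> e) = indefinite_integral X M (\<lambda>x. f x \<bullet> e)"
proof
  fix A
  have "(LINT x:A|M. f x) \<bullet> e = (LINT x:A|M. f x \<bullet> e)" if "A \<in> borel_sets_of X"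
    using set_integrable_of_integrable[OF assms(2), of A] that assms(1)
    unfolding set_lebesgue_integral_def set_integrable_def by (subst integral_inner_left[symmetric]) auto
  then show "indefinite_integral X M f A \<bullet> e = indefinite_integral X M (\<lambda>x. f x \<bullet> e) A"
    by (simp add: indefinite_integral_def)
qed

lemma indefinite_integral_cong_AE:
  assumes "sets M = borel_sets_of X" "integrable M f" "integrable M g" "AE x in M. f x = g x"
  shows "indefinite_integral X M f = indefinite_integral X M g"
proof
  fix A
  have "(LINT x:A|M. f x) = (LINT x:A|M. g x)" if "A \<in> borel_sets_of X"
    using assms that by (intro set_lebesgue_integral_cong_AE) auto
  then show "indefinite_integral X M f A = indefinite_integral X M g A"
    by (simp add: indefinite_integral_def)
qed

lemma indefinite_integral_eq_imp_AE:
  assumes "sets M = borel_sets_of X" "finite_measure M" "integrable M f" "integrable M g"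
    and "indefinite_integral X M f = indefinite_integral X M g"
  shows "AE x in M. f x = g x"
proof (rule sigma_finite_measure.density_unique_banach)
  show "sigma_finite_measure M" using assms(2) by (rule finite_measure.axioms)
  show "set_lebesgue_integral M A f = set_lebesgue_integral M A g" if "A \<in> sets M" for A
    using fun_cong[OF assms(5), of A] that assms(1) by (simp add: indefinite_integral_def)
qed (use assms in auto)

lemma measurable_homeomorphic:
  assumes "continuous_map X X p" "sets M = borel_sets_of X" "sets N = borel_sets_of X"
  shows "p \<in> measurable M N"
proof (rule measurable_sigma_sets)
  show "sets N = sigma_sets (topspace X) {U. openin X U}" using assms(3) by (simp add: borel_sets_of_def)
  show "{U. openin X U} \<subseteq> Pow (topspace X)" by (auto dest: openin_subset)
  show "p \<in> space M \<rightarrow> topspace X"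
    using assms(1) by (simp add: space_borel[OF assms(2)] continuous_map_def)
  show "p -` U \<inter> space M \<in> sets M" if "U \<in> {U. openin X U}" for U
  proof -
    have "p -` U \<inter> space M = {x \<in> topspace X. p x \<in> U}" by (auto simp: space_borel[OF assms(2)])
    then have "openin X (p -` U \<inter> space M)" using assms(1) that by (simp add: continuous_map_def)
    then show ?thesis unfolding assms(2) borel_sets_of_def by (intro sigma_sets.Basic) simp
  qed
qed

text \<open>
Transport of structure; \<open>q\<close> is needed only on \<open>topspace X\<close>, where it inverts \<open>p\<close>.
\<close>

lemma pushforward_indefinite_integral:
  fixes f :: "'x \<Rightarrow> 'k::{real_normed_field, euclidean_space}"
  assumes pq: "homeomorphic_maps X X p q" and M: "sets M = borel_sets_of X" and f: "integrable M f"
  shows "integrable (distr M M p) (\<lambda>y. f (q y))"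
    and "pushforward X p (indefinite_integral X M f) = indefinite_integral X (distr M M p) (\<lambda>y. f (q y))"
proof -
  have p [measurable]: "p \<in> measurable M M" and q [measurable]: "q \<in> measurable M M"
    using pq M by (auto simp: homeomorphic_maps_def intro!: measurable_homeomorphic)
  have [measurable]: "f \<in> borel_measurable M" using f by auto
  have qp: "q (p x) = x" if "x \<in> space M" for x
    using pq that by (simp add: homeomorphic_maps_def space_borel[OF M])
  have "integrable M (\<lambda>x. f (q (p x)))"
    using f by (subst Bochner_Integration.integrable_cong[OF refl, of M _ f]) (auto simp: qp)
  then show "integrable (distr M M p) (\<lambda>y. f (q y))"
    by (subst integrable_distr_eq) auto
  show "pushforward X p (indefinite_integral X M f) = indefinite_integral X (distr M M p) (\<lambda>y. f (q y))"
  proof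
    fix A
    show "pushforward X p (indefinite_integral X M f) A = indefinite_integral X (distr M M p) (\<lambda>y. f (q y)) A"
    proof (cases "A \<in> borel_sets_of X")
      case True
      then have [measurable]: "A \<in> sets M" using M by simp
      have "p -` A \<inter> space M \<in> sets M" by measurable
      then have pA: "p -` A \<inter> topspace X \<in> borel_sets_of X" using M space_borel[OF M] by simp
      have "(LINT y:A|distr M M p. f (q y)) = (\<integral>x. indicator A (p x) *\<^sub>R f (q (p x)) \<partial>M)"
        unfolding set_lebesgue_integral_def by (subst integral_distr) auto
      also have "\<dots> = (LINT x:p -` A \<inter> topspace X|M. f x)"
        unfolding set_lebesgue_integral_def
        by (intro Bochner_Integration.integral_cong) (auto simp: qp indicator_def space_borel[OF M])
      finally show ?thesis using True pA by (simp add: pushforward_def indefinite_integral_def)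
    qed (simp add: pushforward_def indefinite_integral_def)
  qed
qed

lemma convergent_if_geometric_increments:
  fixes f :: "nat \<Rightarrow> real"
  assumes "\<And>n. \<bar>f (Suc n) - f n\<bar> \<le> C * (1/2)^n"
  shows "convergent f"
proof -
  have "summable (\<lambda>n. C * (1/2)^n)" by (intro summable_mult summable_geometric) simp
  then have "summable (\<lambda>n. f (Suc n) - f n)"
    by (rule summable_comparison_test'[where N = 0]) (use assms in auto)
  then have "convergent (\<lambda>n. f n - f 0)"
    by (simp add: summable_iff_convergent sum_lessThan_telescope)
  then show ?thesis by (simp add: convergent_diff_const_right_iff)
qed

text \<open>
The map \<open>q\<close> carries the image measure back to \<open>M\<close>, so null sets pull back to null sets.
\<close>

lemma AE_distr_inverse:
  assumes [measurable]: "p \<in> measurable M M" "q \<in> measurable M M"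
    and qp: "\<And>x. x \<in> space M \<Longrightarrow> q (p x) = x" and P: "AE x in M. P x"
  shows "AE y in distr M M p. P (q y)"
proof -
  have "distr (distr M M p) M q = distr M M (\<lambda>x. q (p x))"
    by (subst distr_distr) (auto simp: comp_def)
  also have "\<dots> = distr M M (\<lambda>x. x)" by (rule distr_cong) (auto simp: qp)
  also have "\<dots> = M" by (rule distr_id)
  finally have D: "distr (distr M M p) M q = M" .
  have "AE y in distr (distr M M p) M q. P y" unfolding D by (rule P)
  then show ?thesis by (rule AE_distrD[rotated]) simp
qed

section \<open>Bounded cocycles\<close>

locale bounded_cocycle = group_action G "topspace X" \<phi>
  for G (structure) and X :: "'x topology" and \<phi> :: "'g \<Rightarrow> 'x \<Rightarrow> 'x" +
  fixes b :: "'g \<Rightarrow> 'x set \<Rightarrow> 'k::{real_normed_field, euclidean_space}" and R :: ennreal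
  assumes Hausdorff: "Hausdorff_space X"
    and homeo: "\<And>g. g \<in> carrier G \<Longrightarrow> homeomorphic_map X X (\<phi> g)"
    and radon: "\<And>g. g \<in> carrier G \<Longrightarrow> b g \<in> radon_measures X"
    and cocycle: "\<And>g h. g \<in> carrier G \<Longrightarrow> h \<in> carrier G
      \<Longrightarrow> b (g \<otimes> h) = (\<lambda>A. b g A + pushforward X (\<phi> g) (b h) A)"
    and bounded: "\<And>g. g \<in> carrier G \<Longrightarrow> tv_norm X (b g) \<le> R" "R < \<infinity>"
begin

sublocale group G
  using group_hom by (simp add: group_hom_def)

lemma homeomorphic_maps_inv:
  assumes "g \<in> carrier G" shows "homeomorphic_maps X X (\<phi> g) (\<phi> (inv g))"
  unfolding homeomorphic_maps_def
proof (intro conjI ballI)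
  show "continuous_map X X (\<phi> g)" "continuous_map X X (\<phi> (inv g))"
    using assms by (auto intro!: homeomorphic_imp_continuous_map homeo)
  show "\<phi> (inv g) (\<phi> g x) = x" if "x \<in> topspace X" for x
    using orbit_sym_aux[OF assms that refl] .
  show "\<phi> g (\<phi> (inv g) x) = x" if "x \<in> topspace X" for x
    using orbit_sym_aux[OF inv_closed[OF assms] that refl] assms by simp
qed

definition density_family :: "'g set \<Rightarrow> 'x measure \<Rightarrow> ('g \<Rightarrow> 'x \<Rightarrow> 'k) \<Rightarrow> bool" where
  "density_family S M \<beta> \<longleftrightarrow> S \<subseteq> carrier G \<and> sets M = borel_sets_of X \<and> finite_measure M \<and>
     (\<forall>h. integrable M (\<beta> h)) \<and> (\<forall>h\<in>S. b h = indefinite_integral X M (\<beta> h))"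

lemma exists_density_family:
  assumes "countable S" "S \<noteq> {}" "S \<subseteq> carrier G"
  shows "\<exists>M \<beta>. density_family S M \<beta> \<and> tight X M"
proof -
  have "\<And>h. h \<in> S \<Longrightarrow> b h \<in> radon_measures X" "\<And>h. h \<in> S \<Longrightarrow> tv_norm X (b h) \<le> R"
    using assms(3) radon bounded(1) by auto
  from exists_common_density[where \<mu> = b, OF Hausdorff assms(1,2) this bounded(2)]
  obtain M \<beta> where M: "sets M = borel_sets_of X" "finite_measure M" "tight X M"
    "\<And>h. integrable M (\<beta> h)" "\<And>h. h \<in> S \<Longrightarrow> b h = indefinite_integral X M (\<beta> h)"
    by metis
  then have "density_family S M \<beta>" using assms(3) by (simp add: density_family_def)
  then show ?thesis using M(3) by blast
qed

text \<open>
The squared distance of \<open>b h\<close> and \<open>b h'\<close> in the Hilbert space of subgraphs. Taking total variations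
coordinatewise makes it independent of any dominating measure. It is invariant because push-forward by
a homeomorphism preserves total variations.
\<close>

definition gap :: "'g \<Rightarrow> 'g \<Rightarrow> real" where
  "gap h h' = (\<Sum>e\<in>Basis. enn2real (tv_norm X (\<lambda>A. (b h A - b h' A) \<bullet> e)))"

lemma gap_integral:
  assumes "density_family S M \<beta>" "h \<in> S" "h' \<in> S"
  shows "gap h h' = (\<Sum>e\<in>Basis. \<integral>x. \<bar>\<beta> h x \<bullet> e - \<beta> h' x \<bullet> e\<bar> \<partial>M)"
  unfolding gap_def
proof (rule sum.cong[OF refl])
  fix e :: 'k
  have M: "sets M = borel_sets_of X" "finite_measure M" "integrable M (\<beta> h)" "integrable M (\<beta> h')"
    using assms by (auto simp: density_family_def)
  have "(\<lambda>A. (b h A - b h' A) \<bullet> e) = indefinite_integral X M (\<lambda>x. (\<beta> h x - \<beta> h' x) \<bullet> e)"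
    using assms M indefinite_integral_diff[OF M(1,3,4)] indefinite_integral_inner[OF M(1), of "\<lambda>x. \<beta> h x - \<beta> h' x" e]
    by (auto simp: density_family_def fun_eq_iff)
  then have "tv_norm X (\<lambda>A. (b h A - b h' A) \<bullet> e) = (\<integral>\<^sup>+x. ennreal (norm ((\<beta> h x - \<beta> h' x) \<bullet> e)) \<partial>M)"
    using M by (simp add: tv_norm_indefinite_integral)
  also have "\<dots> = ennreal (\<integral>x. \<bar>\<beta> h x \<bullet> e - \<beta> h' x \<bullet> e\<bar> \<partial>M)"
    using M by (subst nn_integral_eq_integral) (auto simp: inner_diff_left)
  finally show "enn2real (tv_norm X (\<lambda>A. (b h A - b h' A) \<bullet> e)) = (\<integral>x. \<bar>\<beta> h x \<bullet> e - \<beta> h' x \<bullet> e\<bar> \<partial>M)"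
    by simp
qed

lemma gap_bounded:
  assumes "h \<in> carrier G" "h' \<in> carrier G"
  shows "\<bar>gap h h'\<bar> \<le> real DIM('k) * (2 * enn2real R)"
proof -
  obtain M \<beta> where d: "density_family {h, h'} M \<beta>"
    using exists_density_family[of "{h, h'}"] assms by auto
  then have M: "sets M = borel_sets_of X" "finite_measure M" "\<And>h. integrable M (\<beta> h)" by (auto simp: density_family_def)
  have norm_le: "(\<integral>x. norm (\<beta> k x) \<partial>M) \<le> enn2real R" if "k \<in> {h, h'}" for k
  proof -
    have "ennreal (\<integral>x. norm (\<beta> k x) \<partial>M) = (\<integral>\<^sup>+x. ennreal (norm (\<beta> k x)) \<partial>M)"
      using M(3)[of k] by (subst nn_integral_eq_integral) auto
    also have "\<dots> = tv_norm X (b k)"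
      using d that M by (auto simp: density_family_def tv_norm_indefinite_integral)
    also have "\<dots> \<le> R" using that assms by (auto intro: bounded)
    finally have "enn2real (ennreal (\<integral>x. norm (\<beta> k x) \<partial>M)) \<le> enn2real R"
      using bounded(2) by (intro enn2real_mono) auto
    then show ?thesis by simp
  qed
  have "gap h h' = (\<Sum>e\<in>Basis. \<integral>x. \<bar>\<beta> h x \<bullet> e - \<beta> h' x \<bullet> e\<bar> \<partial>M)" using d by (rule gap_integral) auto
  also have "\<dots> \<le> (\<Sum>e\<in>(Basis :: 'k set). 2 * enn2real R)"
  proof (rule sum_mono)
    fix e :: 'k assume e: "e \<in> Basis"
    have "(\<integral>x. \<bar>\<beta> h x \<bullet> e - \<beta> h' x \<bullet> e\<bar> \<partial>M) \<le> (\<integral>x. norm (\<beta> h x) + norm (\<beta> h' x) \<partial>M)"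
    proof (rule integral_mono)
      fix x
      show "\<bar>\<beta> h x \<bullet> e - \<beta> h' x \<bullet> e\<bar> \<le> norm (\<beta> h x) + norm (\<beta> h' x)"
        using Basis_le_norm[OF e, of "\<beta> h x"] Basis_le_norm[OF e, of "\<beta> h' x"] by linarith
    qed (use M(3) in auto)
    also have "\<dots> \<le> 2 * enn2real R"
      using norm_le[of h] norm_le[of h'] M(3) by simp
    finally show "(\<integral>x. \<bar>\<beta> h x \<bullet> e - \<beta> h' x \<bullet> e\<bar> \<partial>M) \<le> 2 * enn2real R" .
  qed
  finally show ?thesis by (simp add: gap_def sum_nonneg)
qed

lemma gap_invariant:
  assumes g: "g \<in> carrier G" and h: "h \<in> carrier G" "h' \<in> carrier G"
  shows "gap (g \<otimes> h) (g \<otimes> h') = gap h h'"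
proof -
  obtain M \<beta> where d: "density_family {h, h'} M \<beta>"
    using exists_density_family[of "{h, h'}"] h by auto
  then have M: "sets M = borel_sets_of X" "finite_measure M" "\<And>h. integrable M (\<beta> h)" by (auto simp: density_family_def)
  interpret finite_measure M by fact
  note hm = homeomorphic_maps_inv[OF g]
  let ?N = "distr M M (\<phi> g)"
  have p [measurable]: "\<phi> g \<in> measurable M M"
    using hm M by (auto simp: homeomorphic_maps_def intro: measurable_homeomorphic)
  have N: "sets ?N = borel_sets_of X" "finite_measure ?N" using M p by (auto intro: finite_measure_distr)
  let ?d = "\<lambda>x. \<beta> h x - \<beta> h' x" and ?q = "\<phi> (inv g)"
  have i: "integrable M ?d" using M(3) by auto
  have iN: "integrable ?N (\<lambda>y. \<beta> k (?q y))" for k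
    by (rule pushforward_indefinite_integral(1)[OF hm M(1) M(3)])
  have "(\<lambda>A. b (g \<otimes> h) A - b (g \<otimes> h') A) = indefinite_integral X ?N (\<lambda>y. ?d (?q y))"
  proof -
    have "pushforward X (\<phi> g) (b k) = indefinite_integral X ?N (\<lambda>y. \<beta> k (?q y))" if "k \<in> {h, h'}" for k
      using d that pushforward_indefinite_integral(2)[OF hm M(1) M(3)] by (auto simp: density_family_def)
    then have "(\<lambda>A. b (g \<otimes> h) A - b (g \<otimes> h') A) =
        (\<lambda>A. indefinite_integral X ?N (\<lambda>y. \<beta> h (?q y)) A - indefinite_integral X ?N (\<lambda>y. \<beta> h' (?q y)) A)"
      using cocycle g h by simp
    also have "\<dots> = indefinite_integral X ?N (\<lambda>y. ?d (?q y))"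
      by (rule indefinite_integral_diff[OF N(1) iN iN])
    finally show ?thesis .
  qed
  then have left: "(\<lambda>A. (b (g \<otimes> h) A - b (g \<otimes> h') A) \<bullet> e) = indefinite_integral X ?N (\<lambda>y. ?d (?q y) \<bullet> e)" for e
    using indefinite_integral_inner[OF N(1), of "\<lambda>y. ?d (?q y)" e] iN by (simp add: fun_eq_iff)
  have right: "(\<lambda>A. (b h A - b h' A) \<bullet> e) = indefinite_integral X M (\<lambda>x. ?d x \<bullet> e)" for e
    using d M indefinite_integral_diff[OF M(1) M(3) M(3), of h h'] indefinite_integral_inner[OF M(1) i, of e]
    by (auto simp: density_family_def fun_eq_iff)
  have "tv_norm X (\<lambda>A. (b (g \<otimes> h) A - b (g \<otimes> h') A) \<bullet> e) = tv_norm X (\<lambda>A. (b h A - b h' A) \<bullet> e)" for e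
  proof -
    have q [measurable]: "?q \<in> measurable M M"
      using hm M by (auto simp: homeomorphic_maps_def intro: measurable_homeomorphic)
    have [measurable]: "\<beta> k \<in> borel_measurable M" for k using M(3) by auto
    have "tv_norm X (\<lambda>A. (b (g \<otimes> h) A - b (g \<otimes> h') A) \<bullet> e) = (\<integral>\<^sup>+y. ennreal (norm (?d (?q y) \<bullet> e)) \<partial>?N)"
      unfolding left using N iN by (intro tv_norm_indefinite_integral) auto
    also have "\<dots> = (\<integral>\<^sup>+x. ennreal (norm (?d (?q (\<phi> g x)) \<bullet> e)) \<partial>M)"
      by (subst nn_integral_distr) auto
    also have "\<dots> = (\<integral>\<^sup>+x. ennreal (norm (?d x \<bullet> e)) \<partial>M)"
      using hm by (intro nn_integral_cong) (simp add: homeomorphic_maps_def space_borel[OF M(1)])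
    also have "\<dots> = tv_norm X (\<lambda>A. (b h A - b h' A) \<bullet> e)"
      unfolding right using M i by (intro tv_norm_indefinite_integral[symmetric]) auto
    finally show ?thesis .
  qed
  then show ?thesis by (simp add: gap_def)
qed

text \<open>
In terms of densities the energy is the integral over \<open>X\<close> of the energies on the fibres, which by
\<open>integral_tail_square\<close> are squared \<open>L\<^sup>2\<close> norms.
\<close>

lemma energy_gap_integral:
  assumes d: "density_family S M \<beta>" and s: "finite {h. s h \<noteq> 0}" "{h. s h \<noteq> 0} \<subseteq> S"
  shows "integrable M (\<lambda>x. energy (\<lambda>i j. \<bar>\<beta> i x \<bullet> e - \<beta> j x \<bullet> e\<bar>) s)"
    and "energy gap s = (\<Sum>e\<in>Basis. \<integral>x. energy (\<lambda>i j. \<bar>\<beta> i x \<bullet> e - \<beta> j x \<bullet> e\<bar>) s \<partial>M)"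
proof -
  have M: "integrable M (\<beta> h)" for h using d by (auto simp: density_family_def)
  have i: "integrable M (\<lambda>x. \<bar>\<beta> i x \<bullet> e - \<beta> j x \<bullet> e\<bar>)" for i j e using M by auto
  show "integrable M (\<lambda>x. energy (\<lambda>i j. \<bar>\<beta> i x \<bullet> e - \<beta> j x \<bullet> e\<bar>) s)"
    unfolding energy_def using i by auto
  have "energy gap s = - (1/2) * (\<Sum>i | s i \<noteq> 0. \<Sum>j | s j \<noteq> 0. \<Sum>e\<in>Basis. s i * s j * (\<integral>x. \<bar>\<beta> i x \<bullet> e - \<beta> j x \<bullet> e\<bar> \<partial>M))"
    unfolding energy_def sum_distrib_left[symmetric, where A = Basis]
    using gap_integral[OF d] s(2) by (intro arg_cong[where f = "\<lambda>x. - (1/2) * x"] sum.cong refl) auto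
  also have "\<dots> = (\<Sum>e\<in>Basis. - (1/2) * (\<Sum>i | s i \<noteq> 0. \<Sum>j | s j \<noteq> 0. s i * s j * (\<integral>x. \<bar>\<beta> i x \<bullet> e - \<beta> j x \<bullet> e\<bar> \<partial>M)))"
    by (subst sum.swap[where B = Basis], subst sum.swap[where B = Basis]) (simp add: sum_distrib_left)
  also have "\<dots> = (\<Sum>e\<in>Basis. \<integral>x. energy (\<lambda>i j. \<bar>\<beta> i x \<bullet> e - \<beta> j x \<bullet> e\<bar>) s \<partial>M)"
    unfolding energy_def using i by simp
  finally show "energy gap s = (\<Sum>e\<in>Basis. \<integral>x. energy (\<lambda>i j. \<bar>\<beta> i x \<bullet> e - \<beta> j x \<bullet> e\<bar>) s \<partial>M)" .
qed

lemma energy_abs_nonneg: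
  assumes "finite {h. s h \<noteq> 0}" "(\<Sum>h | s h \<noteq> 0. s h) = 0"
  shows "0 \<le> energy (\<lambda>i j. \<bar>q i - q j\<bar>) s"
proof -
  have "energy (\<lambda>i j. \<bar>q i - q j\<bar>) s = (LBINT t. (tail s q t)\<^sup>2)"
    using integral_tail_square[OF assms, of q] by (simp add: has_bochner_integral_iff)
  also have "\<dots> \<ge> 0" by simp
  finally show ?thesis .
qed

lemma energy_gap_nonneg:
  assumes s: "finite {h. s h \<noteq> 0}" "{h. s h \<noteq> 0} \<subseteq> carrier G" "(\<Sum>h | s h \<noteq> 0. s h) = 0"
  shows "0 \<le> energy gap s"
proof (cases "{h. s h \<noteq> 0} = {}")
  case True
  then show ?thesis by (simp add: energy_def)
next
  case False
  obtain M \<beta> where d: "density_family {h. s h \<noteq> 0} M \<beta>"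
    using exists_density_family[OF countable_finite[OF s(1)] False s(2)] by auto
  show ?thesis unfolding energy_gap_integral(2)[OF d s(1) order_refl]
    by (intro sum_nonneg Bochner_Integration.integral_nonneg energy_abs_nonneg s)
qed

text \<open>
Summing with weights \<open>4^n\<close> still gives a finite integral over \<open>X\<close> and the line, so at almost every
point the weighted sum is finite and each term is at most this sum.
\<close>

lemma AE_tail_decay:
  assumes d: "density_family S M \<beta>"
    and s: "\<And>n. finite {h. s n h \<noteq> 0}" "\<And>n. {h. s n h \<noteq> 0} \<subseteq> S" "\<And>n. (\<Sum>h | s n h \<noteq> 0. s n h) = 0"
    and E: "\<And>n. energy gap (s n) \<le> (1/8)^n"
  shows "AE x in M. \<forall>e\<in>Basis. AE t in lborel. \<exists>C. \<forall>n. \<bar>tail (s n) (\<lambda>h. \<beta> h x \<bullet> e) t\<bar> \<le> C * (1/2)^n"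
proof (rule AE_finite_allI)
  fix e :: 'k assume e: "e \<in> Basis"
  let ?T = "\<lambda>n x t. tail (s n) (\<lambda>h. \<beta> h x \<bullet> e) t"
  let ?E = "\<lambda>n x. energy (\<lambda>i j. \<bar>\<beta> i x \<bullet> e - \<beta> j x \<bullet> e\<bar>) (s n)"
  let ?g = "\<lambda>x. \<integral>\<^sup>+t. (\<Sum>n. ennreal (4^n) * ennreal ((?T n x t)\<^sup>2)) \<partial>lborel"
  have Epos: "0 \<le> ?E n x" for n x by (rule energy_abs_nonneg[OF s(1,3)])
  have Eint: "integrable M (?E n)" for n by (rule energy_gap_integral(1)[OF d s(1,2)])
  have Esmall: "(\<integral>x. ?E n x \<partial>M) \<le> (1/8)^n" for n
  proof -
    have "(\<integral>x. ?E n x \<partial>M) \<le> (\<Sum>e\<in>Basis. \<integral>x. energy (\<lambda>i j. \<bar>\<beta> i x \<bullet> e - \<beta> j x \<bullet> e\<bar>) (s n) \<partial>M)"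
      using e by (intro member_le_sum Bochner_Integration.integral_nonneg energy_abs_nonneg s) auto
    also have "\<dots> = energy gap (s n)" by (rule energy_gap_integral(2)[OF d s(1,2), symmetric])
    finally show ?thesis using E[of n] by linarith
  qed
  have g: "?g x = (\<Sum>n. ennreal (4^n) * ennreal (?E n x))" for x
    by (simp add: nn_integral_suminf nn_integral_cmult nn_integral_tail_square[OF s(1,3)])
  have "(\<integral>\<^sup>+x. ?g x \<partial>M) = (\<Sum>n. ennreal (4^n) * (\<integral>\<^sup>+x. ennreal (?E n x) \<partial>M))"
    unfolding g using Eint by (simp add: nn_integral_suminf nn_integral_cmult)
  also have "\<dots> \<le> (\<Sum>n. ennreal ((1/2)^n))"
  proof (rule suminf_le)
    fix n
    have "ennreal (4^n) * (\<integral>\<^sup>+x. ennreal (?E n x) \<partial>M) = ennreal (4^n * (\<integral>x. ?E n x \<partial>M))"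
      using Eint[of n] Epos by (subst nn_integral_eq_integral) (auto simp: ennreal_mult')
    also have "\<dots> \<le> ennreal (4^n * (1/8)^n)" by (intro ennreal_leI mult_left_mono Esmall) simp
    also have "(4::real)^n * (1/8)^n = (1/2)^n" by (simp add: power_mult_distrib[symmetric])
    finally show "ennreal (4^n) * (\<integral>\<^sup>+x. ennreal (?E n x) \<partial>M) \<le> ennreal ((1/2)^n)" .
  qed auto
  also have "\<dots> = ennreal 2"
    using geometric_sums[of "1/2 :: real"] by (intro suminf_ennreal_eq) auto
  finally have "(\<integral>\<^sup>+x. ?g x \<partial>M) \<noteq> \<infinity>" by (auto simp: top_unique)
  moreover have "?g \<in> borel_measurable M" unfolding g using Eint by measurable
  ultimately have "AE x in M. ?g x \<noteq> \<infinity>" by (rule nn_integral_noteq_infinite[rotated])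
  then show "AE x in M. AE t in lborel. \<exists>C. \<forall>n. \<bar>?T n x t\<bar> \<le> C * (1/2)^n"
  proof eventually_elim
    case (elim x)
    have "AE t in lborel. (\<Sum>n. ennreal (4^n) * ennreal ((?T n x t)\<^sup>2)) \<noteq> \<infinity>"
      using elim by (intro nn_integral_noteq_infinite) measurable
    then show ?case
    proof eventually_elim
      case (elim t)
      let ?s = "\<Sum>n. ennreal (4^n) * ennreal ((?T n x t)\<^sup>2)"
      have "\<bar>?T n x t\<bar> \<le> sqrt (enn2real ?s) * (1/2)^n" for n
      proof -
        have "ennreal ((2^n * ?T n x t)\<^sup>2) = ennreal (4^n) * ennreal ((?T n x t)\<^sup>2)"
          by (simp add: ennreal_mult' power_mult_distrib power_mult[symmetric] mult.commute[of n] power_mult)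
        also have "\<dots> \<le> ?s"
          using sum_le_suminf[of "\<lambda>n. ennreal (4^n) * ennreal ((?T n x t)\<^sup>2)" "{n}"] by simp
        finally have "enn2real (ennreal ((2^n * ?T n x t)\<^sup>2)) \<le> enn2real ?s"
          using elim by (intro enn2real_mono) (auto simp: less_top)
        then have "\<bar>2^n * ?T n x t\<bar>\<^sup>2 \<le> enn2real ?s"
          by (simp only: enn2real_ennreal zero_le_power2 power2_abs)
        then have "\<bar>2^n * ?T n x t\<bar> \<le> sqrt (enn2real ?s)" by (rule real_le_rsqrt)
        then show ?thesis by (simp add: abs_mult field_simps)
      qed
      then show ?case by blast
    qed
  qed
qed simp


text \<open>
The differences of successive tail functions decay geometrically at almost every point, so that the
tails converge. Measurability of \<open>w\<close> comes from its definition as a parameter integral, and the bound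
on its norm from the pointwise bound in \<open>limit_mean_exists\<close> and Fatou's lemma.
\<close>

lemma limit_measure:
  assumes d: "density_family S M \<beta>" and c: "\<And>n. c n \<in> fin_prob S"
    and E: "\<And>n. energy gap (\<lambda>h. c (Suc n) h - c n h) \<le> (1/8)^n"
  obtains w where "integrable M w" "(\<integral>\<^sup>+x. ennreal (norm (w x)) \<partial>M) \<le> R"
    "AE x in M. \<forall>e\<in>Basis. limit_mean c (\<lambda>h. \<beta> h x \<bullet> e) (w x \<bullet> e)"
proof -
  have M: "sets M = borel_sets_of X" "finite_measure M" "\<And>h. integrable M (\<beta> h)"
    using d by (auto simp: density_family_def)
  interpret M: finite_measure M by fact
  have [measurable]: "\<beta> h \<in> borel_measurable M" for h using M(3) by auto
  have c_fin: "finite {h. c n h \<noteq> 0}" and c_sub: "{h. c n h \<noteq> 0} \<subseteq> S" and c_pos: "0 \<le> c n h"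
    and c_one: "(\<Sum>h | c n h \<noteq> 0. c n h) = 1" for n h
    using c[of n] by (auto simp: fin_prob_def)
  define F where "F e x t = lim (\<lambda>n. tail (c n) (\<lambda>h. \<beta> h x \<bullet> e) t)" for e x t
  define v where "v e x = (LBINT t. F e x t - below 0 t)" for e x
  define w where "w x = (\<Sum>e\<in>Basis. v e x *\<^sub>R e)" for x
  define L where "L x = liminf (\<lambda>n. ennreal (\<Sum>h | c n h \<noteq> 0. c n h * norm (\<beta> h x)))" for x
  have w_inner: "w x \<bullet> e = v e x" if "e \<in> Basis" for x e
    using that by (simp add: w_def inner_sum_left inner_Basis if_distrib cong: if_cong)
  have [measurable]: "w \<in> borel_measurable M"
  proof -
    have [measurable]: "(\<lambda>(x, t). tail (c n) (\<lambda>h. \<beta> h x \<bullet> e) t) \<in> borel_measurable (M \<Otimes>\<^sub>M lborel)" for n e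
      unfolding tail_def by measurable
    have "(\<lambda>(x, t). F e x t - below 0 t) \<in> borel_measurable (M \<Otimes>\<^sub>M lborel)" for e
      unfolding F_def by measurable
    then have [measurable]: "v e \<in> borel_measurable M" for e
      unfolding v_def by (rule lborel.borel_measurable_lebesgue_integral)
    show ?thesis unfolding w_def by measurable
  qed
  have L_int: "(\<integral>\<^sup>+x. L x \<partial>M) \<le> R"
  proof -
    have "(\<integral>\<^sup>+x. L x \<partial>M) \<le> liminf (\<lambda>n. \<integral>\<^sup>+x. ennreal (\<Sum>h | c n h \<noteq> 0. c n h * norm (\<beta> h x)) \<partial>M)"
      unfolding L_def by (rule nn_integral_liminf) measurable
    also have "\<dots> \<le> liminf (\<lambda>n. R)"
    proof (intro Liminf_mono always_eventually allI)
      fix n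
      have "(\<integral>\<^sup>+x. ennreal (\<Sum>h | c n h \<noteq> 0. c n h * norm (\<beta> h x)) \<partial>M)
          = (\<integral>\<^sup>+x. (\<Sum>h | c n h \<noteq> 0. ennreal (c n h) * ennreal (norm (\<beta> h x))) \<partial>M)"
        using c_pos[of n] by (intro nn_integral_cong) (simp add: sum_ennreal[symmetric] ennreal_mult del: sum_ennreal)
      also have "\<dots> = (\<Sum>h | c n h \<noteq> 0. ennreal (c n h) * (\<integral>\<^sup>+x. ennreal (norm (\<beta> h x)) \<partial>M))"
        by (simp add: nn_integral_sum nn_integral_cmult)
      also have "\<dots> \<le> (\<Sum>h | c n h \<noteq> 0. ennreal (c n h) * R)"
      proof (intro sum_mono mult_left_mono)
        fix h assume "h \<in> {h. c n h \<noteq> 0}"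
        then have h: "h \<in> S" using c_sub by auto
        then have "(\<integral>\<^sup>+x. ennreal (norm (\<beta> h x)) \<partial>M) = tv_norm X (b h)"
          using d M by (simp add: density_family_def tv_norm_indefinite_integral)
        also have "\<dots> \<le> R" using h d by (intro bounded) (auto simp: density_family_def)
        finally show "(\<integral>\<^sup>+x. ennreal (norm (\<beta> h x)) \<partial>M) \<le> R" .
      qed simp
      also have "\<dots> = (\<Sum>h | c n h \<noteq> 0. ennreal (c n h)) * R" by (rule sum_distrib_right[symmetric])
      also have "(\<Sum>h | c n h \<noteq> 0. ennreal (c n h)) = 1" using c_one[of n] c_pos[of n] by simp
      finally show "(\<integral>\<^sup>+x. ennreal (\<Sum>h | c n h \<noteq> 0. c n h * norm (\<beta> h x)) \<partial>M) \<le> R" by simp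
    qed
    finally show ?thesis by (simp add: Liminf_const)
  qed
  have "AE x in M. L x \<noteq> \<infinity>"
    unfolding L_def using L_int bounded(2) unfolding L_def
    by (intro nn_integral_noteq_infinite) (auto simp: top_unique)
  moreover have "AE x in M. \<forall>e\<in>Basis. AE t in lborel. \<exists>C. \<forall>n.
      \<bar>tail (\<lambda>h. c (Suc n) h - c n h) (\<lambda>h. \<beta> h x \<bullet> e) t\<bar> \<le> C * (1/2)^n"
    by (intro AE_tail_decay[OF d] E fin_prob_diff[OF c c])
  ultimately have main: "AE x in M. (\<forall>e\<in>Basis. limit_mean c (\<lambda>h. \<beta> h x \<bullet> e) (w x \<bullet> e)) \<and> ennreal (norm (w x)) \<le> L x"
  proof eventually_elim
    case (elim x)
    have conv: "AE t in lborel. convergent (\<lambda>n. tail (c n) (\<lambda>h. \<beta> h x \<bullet> e) t)" if "e \<in> Basis" for e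
    proof -
      from elim(2) that have "AE t in lborel. \<exists>C. \<forall>n.
        \<bar>tail (\<lambda>h. c (Suc n) h - c n h) (\<lambda>h. \<beta> h x \<bullet> e) t\<bar> \<le> C * (1/2)^n" by blast
      then show ?thesis
        unfolding tail_diff[OF c_fin c_fin]
        by eventually_elim (auto intro: convergent_if_geometric_increments)
    qed
    have fin: "liminf (\<lambda>n. ennreal (\<Sum>h | c n h \<noteq> 0. c n h * norm (\<beta> h x))) < \<infinity>"
      using elim(1) by (simp add: L_def less_top)
    note lm = limit_mean_exists[where p = "\<lambda>h. \<beta> h x", OF c conv fin, folded F_def, folded v_def, folded w_def L_def]
    show ?case using lm w_inner by simp
  qed
  have norm_w: "(\<integral>\<^sup>+x. ennreal (norm (w x)) \<partial>M) \<le> R"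
    using main by (intro order_trans[OF nn_integral_mono_AE L_int]) auto
  show thesis
  proof (rule that)
    show "integrable M w" using norm_w bounded(2) by (intro integrableI_bounded) (auto intro: le_less_trans)
    show "AE x in M. \<forall>e\<in>Basis. limit_mean c (\<lambda>h. \<beta> h x \<bullet> e) (w x \<bullet> e)" using main by eventually_elim simp
  qed (rule norm_w)
qed

lemma tail_translate:
  assumes "g \<in> carrier G" "{h. s h \<noteq> 0} \<subseteq> carrier G"
  shows "tail (translate G g s) q t = tail s (\<lambda>h. q (g \<otimes> h)) t"
  unfolding tail_def by (rule sum_translate[OF assms, of "\<lambda>h a. a * below (q h) t"])

text \<open>
Everything is moved to one measure \<open>M1\<close> that dominates \<open>M\<close>, its image under \<open>g\<close> and \<open>b g\<close>. At almost
every \<open>x\<close> both sides are then means of limits of distributions of the values \<open>\<gamma> h x\<close>: the left side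
for the weights \<open>c n\<close>, the right side for their translates by \<open>g\<close>. These limits agree.
\<close>

lemma limit_measure_equivariant:
  assumes d: "density_family S M \<beta>" and c: "\<And>n. c n \<in> fin_prob S"
    and S: "countable S"
    and w: "integrable M w" "AE x in M. \<forall>e\<in>Basis. limit_mean c (\<lambda>h. \<beta> h x \<bullet> e) (w x \<bullet> e)"
    and g: "g \<in> carrier G" and E: "\<And>n. energy gap (\<lambda>h. translate G g (c n) h - c n h) \<le> (1/8)^n"
  shows "indefinite_integral X M w =
    (\<lambda>A. b g A + pushforward X (\<phi> g) (indefinite_integral X M w) A)"
proof -
  have M: "sets M = borel_sets_of X" "finite_measure M" "\<And>h. integrable M (\<beta> h)"
    and SG: "S \<subseteq> carrier G" and b: "\<And>h. h \<in> S \<Longrightarrow> b h = indefinite_integral X M (\<beta> h)"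
    using d by (auto simp: density_family_def)
  interpret M: finite_measure M by fact
  have cG: "c n \<in> fin_prob (carrier G)" for n using c[of n] SG by (auto simp: fin_prob_def)
  have c_sub: "{h. c n h \<noteq> 0} \<subseteq> S" for n using c[of n] by (simp add: fin_prob_def)
  let ?q = "\<phi> (inv g)" and ?Mg = "distr M M (\<phi> g)"
  note hm = homeomorphic_maps_inv[OF g]
  have p [measurable]: "\<phi> g \<in> measurable M M" and q [measurable]: "?q \<in> measurable M M"
    using hm M by (auto simp: homeomorphic_maps_def intro: measurable_homeomorphic)
  note push = pushforward_indefinite_integral[OF hm M(1)]
  have sa: "sigma_additive X (b g)" using radon[OF g] by (simp add: radon_measures_iff)
  have fin: "tv_norm X (b g) < \<infinity>" using bounded(1)[OF g] bounded(2) by (rule le_less_trans)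
  \<comment> \<open>Three measures to be dominated, as a sequence that is constant from index 2 on.\<close>
  define N where "N i = (if i = 0 then M else if i = 1 then ?Mg else variation_measure X (b g))" for i :: nat
  have N: "sets (N i) = borel_sets_of X" "finite_measure (N i)" for i
    using M finite_measure_variation_measure[OF sa fin]
    by (auto simp: N_def sets_variation_measure intro: M.finite_measure_distr)
  have "measure (N i) (topspace X) \<le> Max ((\<lambda>i. measure (N i) (topspace X)) ` {0, 1, 2})" for i
  proof -
    have "N i = N (min i 2)" by (auto simp: N_def)
    moreover have "min i 2 \<in> {0, 1, 2}" by auto
    ultimately show ?thesis by (intro Max_ge) auto
  qed
  then obtain M1 where M1: "sets M1 = borel_sets_of X" "finite_measure M1" and ac: "\<And>i. absolutely_continuous M1 (N i)"
    using exists_dominating_measure[of X N, OF Hausdorff N] by metis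
  obtain D0 where D0: "integrable M1 D0" "\<And>x. 0 \<le> D0 x" "M = density M1 (\<lambda>x. ennreal (D0 x))"
    using ac[of 0] M M1 by (auto simp: N_def intro: Radon_Nikodym_finite[of M1 M])
  obtain Dg where Dg: "integrable M1 Dg" "\<And>x. 0 \<le> Dg x" "?Mg = density M1 (\<lambda>x. ennreal (Dg x))"
    using ac[of 1] N(2)[of 1] M M1 by (auto simp: N_def intro: Radon_Nikodym_finite[of M1 ?Mg])
  obtain \<zeta> where \<zeta>: "integrable M1 \<zeta>" "b g = indefinite_integral X M1 \<zeta>"
    using exists_density[OF sa fin M1] ac[of 2] by (auto simp: N_def)
  have [measurable]: "D0 \<in> borel_measurable M1" "Dg \<in> borel_measurable M1" using D0(1) Dg(1) by auto
  have base0: "integrable M1 (\<lambda>x. D0 x *\<^sub>R f x)"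
    "indefinite_integral X M f = indefinite_integral X M1 (\<lambda>x. D0 x *\<^sub>R f x)"
    if "integrable M f" for f :: "'x \<Rightarrow> 'k"
    using indefinite_integral_density[OF M1(1) _ D0(2), where f = f] that D0(3) by auto
  have baseg: "integrable M1 (\<lambda>x. Dg x *\<^sub>R f (?q x))"
    "pushforward X (\<phi> g) (indefinite_integral X M f) = indefinite_integral X M1 (\<lambda>x. Dg x *\<^sub>R f (?q x))"
    if "integrable M f" for f :: "'x \<Rightarrow> 'k"
    using indefinite_integral_density[OF M1(1) _ Dg(2), where f = "\<lambda>x. f (?q x)"] push[OF that] Dg(3) by auto
  \<comment> \<open>The affine action on densities: if \<open>\<nu>\<close> has density f with respect to M, then \<open>b g + g.\<nu>\<close> has
    density ?T f with respect to M1.\<close>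
  let ?T = "\<lambda>f x. \<zeta> x + Dg x *\<^sub>R f (?q x)"
  have T: "integrable M1 (?T f)"
    "(\<lambda>A. b g A + pushforward X (\<phi> g) (indefinite_integral X M f) A) = indefinite_integral X M1 (?T f)"
    if "integrable M f" for f
    using \<zeta> baseg[OF that] indefinite_integral_add[OF M1(1) \<zeta>(1) baseg(1)[OF that]] by auto
  \<comment> \<open>S and its translate by g may overlap, and there the density is prescribed twice. By uniqueness of
    densities the two prescriptions agree almost everywhere.\<close>
  define \<gamma> where "\<gamma> h = (if h \<in> S then (\<lambda>x. D0 x *\<^sub>R \<beta> h x) else ?T (\<beta> (inv g \<otimes> h)))" for h
  have \<gamma>_int: "integrable M1 (\<gamma> h)" for h using base0(1) T(1) M(3) by (simp add: \<gamma>_def)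
  have bT: "b (g \<otimes> h) = indefinite_integral X M1 (?T (\<beta> h))" if "h \<in> S" for h
    using cocycle[OF g, of h] b[OF that] T(2)[OF M(3)[of h]] SG that by auto
  have d1: "density_family (S \<union> (\<lambda>h. g \<otimes> h) ` S) M1 \<gamma>"
    unfolding density_family_def
  proof (intro conjI ballI allI)
    fix h assume h: "h \<in> S \<union> (\<lambda>h. g \<otimes> h) ` S"
    show "b h = indefinite_integral X M1 (\<gamma> h)"
    proof (cases "h \<in> S")
      case True
      then show ?thesis using b base0(2)[OF M(3)] by (simp add: \<gamma>_def)
    next
      case False
      with h obtain k where k: "k \<in> S" "h = g \<otimes> k" by auto
      then have "inv g \<otimes> h = k" using g SG by (auto simp: m_assoc[symmetric])
      then show ?thesis using False k bT[OF k(1)] by (simp add: \<gamma>_def)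
    qed
  qed (use SG g M1 \<gamma>_int in auto)
  have \<gamma>_moved: "AE x in M1. \<forall>h\<in>S. \<gamma> (g \<otimes> h) x = ?T (\<beta> h) x"
  proof (subst AE_ball_countable[OF S], intro ballI)
    fix h assume h: "h \<in> S"
    then have "b (g \<otimes> h) = indefinite_integral X M1 (\<gamma> (g \<otimes> h))" using d1 by (auto simp: density_family_def)
    then have "indefinite_integral X M1 (\<gamma> (g \<otimes> h)) = indefinite_integral X M1 (?T (\<beta> h))" using bT[OF h] by simp
    then show "AE x in M1. \<gamma> (g \<otimes> h) x = ?T (\<beta> h) x"
      by (rule indefinite_integral_eq_imp_AE[OF M1 \<gamma>_int T(1)[OF M(3)]])
  qed
  \<comment> \<open>Where the density D0 or Dg vanishes, almost everywhere statements about M or its image say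
    nothing, and the degenerate case of \<open>limit_mean_affine\<close> takes over.\<close>
  have lim0: "AE x in M1. 0 < ennreal (D0 x) \<longrightarrow> (\<forall>e\<in>Basis. limit_mean c (\<lambda>h. \<beta> h x \<bullet> e) (w x \<bullet> e))"
    using w(2) by (subst (asm) D0(3), subst (asm) AE_density) auto
  have "AE y in ?Mg. \<forall>e\<in>Basis. limit_mean c (\<lambda>h. \<beta> h (?q y) \<bullet> e) (w (?q y) \<bullet> e)"
    using hm by (intro AE_distr_inverse[OF p q _ w(2)]) (simp add: homeomorphic_maps_def space_borel[OF M(1)])
  then have limg: "AE x in M1. 0 < ennreal (Dg x) \<longrightarrow>
      (\<forall>e\<in>Basis. limit_mean c (\<lambda>h. \<beta> h (?q x) \<bullet> e) (w (?q x) \<bullet> e))"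
    by (subst (asm) Dg(3), subst (asm) AE_density) auto
  have decay: "AE x in M1. \<forall>e\<in>Basis. AE t in lborel. \<exists>C. \<forall>n.
      \<bar>tail (\<lambda>h. translate G g (c n) h - c n h) (\<lambda>h. \<gamma> h x \<bullet> e) t\<bar> \<le> C * (1/2)^n"
  proof (rule AE_tail_decay[OF d1])
    fix n
    show "{h. translate G g (c n) h - c n h \<noteq> 0} \<subseteq> S \<union> (\<lambda>h. g \<otimes> h) ` S"
    proof -
      have "{h. c n h \<noteq> 0} \<subseteq> carrier G" using c_sub[of n] SG by (rule order_trans)
      then have gS: "{h. translate G g (c n) h \<noteq> 0} \<subseteq> (\<lambda>h. g \<otimes> h) ` S"
        using translate_support[OF g, of "c n"] image_mono[OF c_sub[of n], of "\<lambda>h. g \<otimes> h"] by simp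
      have "{h. translate G g (c n) h - c n h \<noteq> 0} \<subseteq> {h. c n h \<noteq> 0} \<union> {h. translate G g (c n) h \<noteq> 0}"
        by auto
      also have "\<dots> \<subseteq> S \<union> (\<lambda>h. g \<otimes> h) ` S" using c_sub[of n] gS by (rule Un_mono)
      finally show ?thesis .
    qed
  qed (use fin_prob_diff[OF translate_fin_prob[OF g cG] cG] E in auto)
  have "AE x in M1. D0 x *\<^sub>R w x = ?T w x"
    using \<gamma>_moved lim0 limg decay
  proof eventually_elim
    case (elim x)
    show ?case
    proof (rule euclidean_eqI)
      fix e :: 'k assume e: "e \<in> Basis"
      have "limit_mean c (\<lambda>h. 0 + D0 x * (\<beta> h x \<bullet> e)) (0 + D0 x * (w x \<bullet> e))"
        using elim(2) e D0(2) by (intro limit_mean_affine[OF c]) auto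
      then have l0: "limit_mean c (\<lambda>h. \<gamma> h x \<bullet> e) (D0 x *\<^sub>R w x \<bullet> e)"
        using c_sub by (intro limit_mean_cong[of c "\<lambda>h. 0 + D0 x * (\<beta> h x \<bullet> e)" "\<lambda>h. \<gamma> h x \<bullet> e"])
          (auto simp: \<gamma>_def subset_iff)
      have "limit_mean c (\<lambda>h. \<zeta> x \<bullet> e + Dg x * (\<beta> h (?q x) \<bullet> e)) (\<zeta> x \<bullet> e + Dg x * (w (?q x) \<bullet> e))"
        using elim(3) e Dg(2) by (intro limit_mean_affine[OF c]) auto
      then have lg: "limit_mean c (\<lambda>h. \<gamma> (g \<otimes> h) x \<bullet> e) (?T w x \<bullet> e)"
        using c_sub elim(1)
        by (intro limit_mean_cong[of c "\<lambda>h. \<zeta> x \<bullet> e + Dg x * (\<beta> h (?q x) \<bullet> e)" "\<lambda>h. \<gamma> (g \<otimes> h) x \<bullet> e"])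
          (auto simp: inner_add_left subset_iff)
      show "D0 x *\<^sub>R w x \<bullet> e = ?T w x \<bullet> e"
      proof (rule limit_mean_unique[OF lg l0, symmetric])
        from elim(4) e have "AE t in lborel. \<exists>C. \<forall>n.
          \<bar>tail (\<lambda>h. translate G g (c n) h - c n h) (\<lambda>h. \<gamma> h x \<bullet> e) t\<bar> \<le> C * (1/2)^n" by blast
        then show "AE t in lborel. (\<lambda>n. tail (c n) (\<lambda>h. \<gamma> (g \<otimes> h) x \<bullet> e) t - tail (c n) (\<lambda>h. \<gamma> h x \<bullet> e) t) \<longlonglongrightarrow> 0"
        proof eventually_elim
          case (elim t)
          then obtain C where C: "\<And>n. \<bar>tail (\<lambda>h. translate G g (c n) h - c n h) (\<lambda>h. \<gamma> h x \<bullet> e) t\<bar> \<le> C * (1/2)^n"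
            by blast
          have eq: "tail (\<lambda>h. translate G g (c n) h - c n h) (\<lambda>h. \<gamma> h x \<bullet> e) t =
              tail (c n) (\<lambda>h. \<gamma> (g \<otimes> h) x \<bullet> e) t - tail (c n) (\<lambda>h. \<gamma> h x \<bullet> e) t" for n
          proof -
            have "finite {h. translate G g (c n) h \<noteq> 0}" "finite {h. c n h \<noteq> 0}"
              using translate_fin_prob[OF g cG[of n]] c[of n] by (auto simp: fin_prob_def)
            then show ?thesis
              using tail_translate[OF g, of "c n"] c_sub[of n] SG by (simp add: tail_diff)
          qed
          have "(\<lambda>n. C * (1/2)^n) \<longlonglongrightarrow> C * 0" by (intro tendsto_intros LIMSEQ_power_zero) simp
          then have "(\<lambda>n. C * (1/2)^n) \<longlonglongrightarrow> 0" by simp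
          moreover have "\<forall>n. norm (tail (c n) (\<lambda>h. \<gamma> (g \<otimes> h) x \<bullet> e) t - tail (c n) (\<lambda>h. \<gamma> h x \<bullet> e) t) \<le> C * (1/2)^n"
            using C unfolding eq by simp
          ultimately show ?case by (rule Lim_null_comparison[OF always_eventually, rotated])
        qed
      qed
    qed
  qed
  then have "indefinite_integral X M1 (\<lambda>x. D0 x *\<^sub>R w x) = indefinite_integral X M1 (?T w)"
    by (intro indefinite_integral_cong_AE[OF M1(1)] base0(1) T(1) w(1))
  then show ?thesis using base0(2)[OF w(1)] T(2)[OF w(1)] by simp
qed

theorem exists_trivializing_measure:
  "\<exists>\<mu>\<in>radon_measures X. tv_norm X \<mu> \<le> R \<and>
     (\<forall>g\<in>carrier G. b g = (\<lambda>A. \<mu> A - pushforward X (\<phi> g) \<mu> A))"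
proof -
  obtain c where c: "\<And>n. c n \<in> fin_prob (carrier G)"
    and E: "\<And>n. energy gap (\<lambda>h. c (Suc n) h - c n h) \<le> (1/8)^n"
    and Eg: "\<And>n g. g \<in> carrier G \<Longrightarrow> energy gap (\<lambda>h. translate G g (c n) h - c n h) \<le> (1/8)^n"
    using asymptotically_invariant_centres[OF gap_invariant gap_bounded energy_gap_nonneg] by blast
  \<comment> \<open>The centres are carried by a countable set; the unit makes it nonempty.\<close>
  define S where "S = insert \<one> (\<Union>n. {h. c n h \<noteq> 0})"
  have "countable S" using c by (auto simp: S_def fin_prob_def intro: countable_finite)
  moreover have "S \<subseteq> carrier G" using c by (auto simp: S_def fin_prob_def)
  ultimately obtain M \<beta> where d: "density_family S M \<beta>" "tight X M"
    using exists_density_family[of S] by (auto simp: S_def)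
  have cS: "c n \<in> fin_prob S" for n using c[of n] by (auto simp: fin_prob_def S_def)
  obtain w where w: "integrable M w" "(\<integral>\<^sup>+x. ennreal (norm (w x)) \<partial>M) \<le> R"
    "AE x in M. \<forall>e\<in>Basis. limit_mean c (\<lambda>h. \<beta> h x \<bullet> e) (w x \<bullet> e)"
    using limit_measure[OF d(1) cS E] by blast
  have M: "sets M = borel_sets_of X" "finite_measure M" using d by (auto simp: density_family_def)
  let ?\<mu> = "indefinite_integral X M w"
  show ?thesis
  proof (intro bexI conjI ballI)
    show "?\<mu> \<in> radon_measures X" by (rule radon_indefinite_integral[OF Hausdorff M d(2) w(1)])
    show "tv_norm X ?\<mu> \<le> R" using w(2) by (simp add: tv_norm_indefinite_integral[OF M w(1)])
    fix g assume g: "g \<in> carrier G"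
    have "?\<mu> A = b g A + pushforward X (\<phi> g) ?\<mu> A" for A
      using fun_cong[OF limit_measure_equivariant[OF d(1) cS \<open>countable S\<close> w(1,3) g Eg[OF g]], of A] .
    then show "b g = (\<lambda>A. ?\<mu> A - pushforward X (\<phi> g) ?\<mu> A)" by (simp add: fun_eq_iff)
  qed
qed

end

theorem corollary2:
  fixes G :: "('g, 'm) monoid_scheme"
    and X :: "'x topology"
    and \<phi> :: "'g \<Rightarrow> 'x \<Rightarrow> 'x"
    and b :: "'g \<Rightarrow> 'x set \<Rightarrow> 'k::{real_normed_field, euclidean_space}"
  assumes "locally_compact_space X" and "Hausdorff_space X"
    and "group_action G (topspace X) \<phi>"
    and "\<And>g. g \<in> carrier G \<Longrightarrow> homeomorphic_map X X (\<phi> g)"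
    and "measure_cocycle G X \<phi> b"
    and "(SUP g \<in> carrier G. tv_norm X (b g)) < \<infinity>"
  shows "\<exists>\<mu> \<in> radon_measures X.
           tv_norm X \<mu> \<le> (SUP g \<in> carrier G. tv_norm X (b g)) \<and>
           (\<forall>g \<in> carrier G. b g = (\<lambda>A. \<mu> A - pushforward X (\<phi> g) \<mu> A))"
proof -
  have "bounded_cocycle G X \<phi> b (SUP g \<in> carrier G. tv_norm X (b g))"
    using assms unfolding bounded_cocycle_def bounded_cocycle_axioms_def measure_cocycle_def
    by (auto intro: SUP_upper)
  then show ?thesis by (rule bounded_cocycle.exists_trivializing_measure)
qed

end
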